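(* Let $P$ be a finite TAOS and let $Q$ be its Hasse quiver. Suppose that every algebraically connected component of $Q$ is the Hasse quiver of some array TAOS. Suppose moreover that for any two distinct algebraically connected components $Q^i$ and $Q^j$ of $Q$ there do not exist paths $p_i$ in $Q^i$ and $p_j$ in $Q^j$, both of length at least two, such that $s(p_i)=s(p_j)$ and $t(p_i)=t(p_j)$. Then there exists an inner product $\langle\cdot,\cdot\rangle$ on $R(P)$ such that $(R(P),\langle\cdot,\cdot\rangle)$ is an algebraic Ricci soliton with respect to $-1$, i.e. $\mathrm{Ric}=-\mathrm{id}+D$ for some $D\in\mathrm{Der}(R(P))$.
   Context: A transitively and antisymmetrically ordered set (TAOS) is a set $P$ with a binary relation $\prec$ that is transitive and antisymmetric ($s\prec t$, $t\prec s$ imply $s=t$); it need be neither reflexive nor irreflexive. Lie algebra of a finite TAOS: $R(P)$ is the real vector space with basis $B(P)=\{(s,t)\mid s,t\in P,\ s\prec t\}\setminus\{(u,u)\mid u\in P,\ u\prec u\}$, with bilinear product determined by $(s,t)\cdot(u,v)=(s,v)$ if $t=u$ and $0$ if $t\ne u$, and Lie bracket $[x,y]=x\cdot y-y\cdot x$. Hasse quiver of a TAOS $P$: the quiver with vertex set $P$ and with exactly one arrow from $a$ to $b$ whenever $a\prec b$, $a\neq b$, and there is no $t\in P\setminus\{a,b\}$ with $a\prec t\prec b$ (no other arrows). For a path $p$, $s(p)$ and $t(p)$ are its starting and terminal vertices; its length is its number of arrows. Path algebra: for a finite acyclic quiver $Q$, $\mathfrak{n}_Q$ is the real associative algebra with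 basis all paths of length $\ge 1$ in $Q$, with product given by concatenation of paths ($xy$ if $xy$ is a path, and $0$ otherwise). Algebraic connectivity: a finite quiver $Q$ is algebraically connected if $\mathfrak{n}_Q$ is not isomorphic, as an associative algebra, to a direct sum of more than one (nonzero) path algebra of a quiver. In general $\mathfrak{n}_Q=\bigoplus_{i=1}^n \mathfrak{n}_{E_i}$ where the $E_i$ are algebraically connected subquivers of $Q$ (each having at least one arrow and no isolated vertices; the direct sum is internal, so the arrow sets of the $E_i$ partition the arrow set of $Q$, while different $E_i$ may share vertices). The $E_i$ are the algebraically connected components of $Q$. Array TAOS: given integers $k\ge 2$, $n_1,\dots,n_k\ge 1$, and $m_1,\dots,m_k$ with $1\le m_i\le n_i$, $m_1=n_1$, $m_k=n_k$, let $P$ be a set with $\sum_{i=1}^k n_i$ elements partitioned into $k$ columns, the $i$-th column having $n_i$ elements. For each $i=1,\dots,k-1$ choose $m_{i+1}$ elements of the $(i+1)$-th column and declare $\eta_i\prec\eta_{i+1}$ for each element $\eta_i$ of the $i$-th column and each of the $m_{i+1}$ chosen elements $\eta_{i+1}$ of the $(i+1)$-th column. The relation $\prec$ on $P$ is the transitive closure of these relations. Curvature of a metric Lie algebra $(\mathfrak g,\langle\cdot,\cdot\rangle)$ (a finite-dimensional real Lie algebra with inner product): the Levi-Civita connection $\nabla$ is defined by $2\langle\nabla_XY,Z\rangle=\langle[X,Y],Z\rangle+\langle[Z,X],Y\rangle+\langle X,[Z,Y]\rangle$; $R(X,Y)Z=\nabla_X\nabla_YZ-\nabla_Y\nabla_XZ-\nabla_{[X,Y]}Z$;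 and $\mathrm{Ric}(X)=\sum_i R(X,e_i)e_i$ for an orthonormal basis $\{e_i\}$. $\mathrm{Der}(\mathfrak g)$ is the set of derivations. $(\mathfrak g,\langle\cdot,\cdot\rangle)$ is an algebraic Ricci soliton with respect to $c\in\mathbb{R}$ if $\mathrm{Ric}=c\cdot\mathrm{id}+D$ for some $D\in\mathrm{Der}(\mathfrak g)$. *)

theory Defs
  imports "HOL-Analysis.Analysis" "HOL-Analysis.Finite_Function_Topology" "Graph_Theory.Digraph_Component"
begin

section \<open>Linear algebra and Lie algebras on subspaces\<close>

text \<open>
  Vector spaces and algebras are subspaces \<open>V\<close> of an ambient real vector space. Maps are total
  functions on the ambient type; only their values on \<open>V\<close> are constrained and used.
\<close>

definition linear_on :: "'v::real_vector set \<Rightarrow> ('v \<Rightarrow> 'w::real_vector) \<Rightarrow> bool" where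
  "linear_on V f \<longleftrightarrow>
     (\<forall>x\<in>V. \<forall>y\<in>V. f (x + y) = f x + f y) \<and> (\<forall>c. \<forall>x\<in>V. f (c *\<^sub>R x) = c *\<^sub>R f x)"

definition bilinear_on :: "'v::real_vector set \<Rightarrow> ('v \<Rightarrow> 'v \<Rightarrow> 'w::real_vector) \<Rightarrow> bool" where
  "bilinear_on V f \<longleftrightarrow>
     (\<forall>x\<in>V. linear_on V (\<lambda>y. f x y)) \<and> (\<forall>y\<in>V. linear_on V (\<lambda>x. f x y))"

definition lie_algebra_on :: "'v::real_vector set \<Rightarrow> ('v \<Rightarrow> 'v \<Rightarrow> 'v) \<Rightarrow> bool" where
  "lie_algebra_on V br \<longleftrightarrow>
     subspace V \<and> (\<forall>x\<in>V. \<forall>y\<in>V. br x y \<in> V) \<and> bilinear_on V br \<and>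
     (\<forall>x\<in>V. br x x = 0) \<and>
     (\<forall>x\<in>V. \<forall>y\<in>V. \<forall>z\<in>V. br x (br y z) + br y (br z x) + br z (br x y) = 0)"

definition inner_product_on :: "'v::real_vector set \<Rightarrow> ('v \<Rightarrow> 'v \<Rightarrow> real) \<Rightarrow> bool" where
  "inner_product_on V ip \<longleftrightarrow>
     bilinear_on V ip \<and> (\<forall>x\<in>V. \<forall>y\<in>V. ip x y = ip y x) \<and> (\<forall>x\<in>V. x \<noteq> 0 \<longrightarrow> ip x x > 0)"

definition metric_lie_algebra ::
    "'v::real_vector set \<Rightarrow> ('v \<Rightarrow> 'v \<Rightarrow> 'v) \<Rightarrow> ('v \<Rightarrow> 'v \<Rightarrow> real) \<Rightarrow> bool" where
  "metric_lie_algebra V br ip \<longleftrightarrow>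
     lie_algebra_on V br \<and> (\<exists>B. finite B \<and> span B = V) \<and> inner_product_on V ip"

definition orthonormal_basis ::
    "'v::real_vector set \<Rightarrow> ('v \<Rightarrow> 'v \<Rightarrow> real) \<Rightarrow> 'v set \<Rightarrow> bool" where
  "orthonormal_basis V ip B \<longleftrightarrow>
     finite B \<and> span B = V \<and> (\<forall>x\<in>B. \<forall>y\<in>B. ip x y = (if x = y then 1 else 0))"

definition levi_civita ::
    "'v::real_vector set \<Rightarrow> ('v \<Rightarrow> 'v \<Rightarrow> 'v) \<Rightarrow> ('v \<Rightarrow> 'v \<Rightarrow> real) \<Rightarrow> 'v \<Rightarrow> 'v \<Rightarrow> 'v" where
  "levi_civita V br ip X Y =
     (THE W. W \<in> V \<and>
        (\<forall>Z\<in>V. 2 * ip W Z = ip (br X Y) Z + ip (br Z X) Y + ip X (br Z Y)))"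

definition curvature ::
    "'v::real_vector set \<Rightarrow> ('v \<Rightarrow> 'v \<Rightarrow> 'v) \<Rightarrow> ('v \<Rightarrow> 'v \<Rightarrow> real) \<Rightarrow> 'v \<Rightarrow> 'v \<Rightarrow> 'v \<Rightarrow> 'v" where
  "curvature V br ip X Y Z =
     levi_civita V br ip X (levi_civita V br ip Y Z)
     - levi_civita V br ip Y (levi_civita V br ip X Z)
     - levi_civita V br ip (br X Y) Z"

text \<open>The Ricci operator does not depend on the orthonormal basis, so an arbitrary one is chosen.\<close>

definition ricci ::
    "'v::real_vector set \<Rightarrow> ('v \<Rightarrow> 'v \<Rightarrow> 'v) \<Rightarrow> ('v \<Rightarrow> 'v \<Rightarrow> real) \<Rightarrow> 'v \<Rightarrow> 'v" where
  "ricci V br ip X =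
     (\<Sum>e\<in>(SOME B. orthonormal_basis V ip B). curvature V br ip X e e)"

definition derivations :: "'v::real_vector set \<Rightarrow> ('v \<Rightarrow> 'v \<Rightarrow> 'v) \<Rightarrow> ('v \<Rightarrow> 'v) set" where
  "derivations V br =
     {D. linear_on V D \<and> (\<forall>x\<in>V. D x \<in> V) \<and>
         (\<forall>x\<in>V. \<forall>y\<in>V. D (br x y) = br (D x) y + br x (D y))}"

definition algebraic_ricci_soliton ::
    "'v::real_vector set \<Rightarrow> ('v \<Rightarrow> 'v \<Rightarrow> 'v) \<Rightarrow> ('v \<Rightarrow> 'v \<Rightarrow> real) \<Rightarrow> real \<Rightarrow> bool" where
  "algebraic_ricci_soliton V br ip c \<longleftrightarrow>
     metric_lie_algebra V br ip \<and>
     (\<exists>D\<in>derivations V br. \<forall>X\<in>V. ricci V br ip X = c *\<^sub>R X + D X)"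

section \<open>Algebras with a basis on which the product is partially defined\<close>

text \<open>
  \<open>free_space B\<close> is the real vector space with basis \<open>B\<close>: the finitely supported functions with
  support in \<open>B\<close>, where \<open>b \<in> B\<close> is identified with \<open>Poly_Mapping.single b 1\<close>.
  \<open>basis_mult m\<close> is the bilinear product which sends the basis elements \<open>a\<close> and \<open>b\<close> to \<open>c\<close> if
  \<open>m a b = Some c\<close>, and to \<open>0\<close> if \<open>m a b = None\<close>.
\<close>

definition free_space :: "'b set \<Rightarrow> ('b \<Rightarrow>\<^sub>0 real) set" where
  "free_space B = {x. Poly_Mapping.keys x \<subseteq> B}"

definition basis_mult ::
    "('b \<Rightarrow> 'b \<Rightarrow> 'b option) \<Rightarrow> ('b \<Rightarrow>\<^sub>0 real) \<Rightarrow> ('b \<Rightarrow>\<^sub>0 real) \<Rightarrow> ('b \<Rightarrow>\<^sub>0 real)" where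
  "basis_mult m x y =
     (\<Sum>a\<in>Poly_Mapping.keys x. \<Sum>b\<in>Poly_Mapping.keys y.
        case m a b of
          None \<Rightarrow> 0
        | Some c \<Rightarrow> Poly_Mapping.single c (Poly_Mapping.lookup x a * Poly_Mapping.lookup y b))"

section \<open>Isomorphisms and direct sums of algebras\<close>

definition algebras_isomorphic ::
    "'v::real_vector set \<Rightarrow> ('v \<Rightarrow> 'v \<Rightarrow> 'v) \<Rightarrow>
     'w::real_vector set \<Rightarrow> ('w \<Rightarrow> 'w \<Rightarrow> 'w) \<Rightarrow> bool" where
  "algebras_isomorphic V mV W mW \<longleftrightarrow>
     (\<exists>f. linear_on V f \<and> bij_betw f V W \<and> (\<forall>x\<in>V. \<forall>y\<in>V. f (mV x y) = mW (f x) (f y)))"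

text \<open>
  External direct sum of algebras \<open>(W i, mul i)\<close>, \<open>i < n\<close>: families vanishing outside of
  \<open>{..<n}\<close>, with componentwise product.
\<close>

definition direct_sum_space :: "nat \<Rightarrow> (nat \<Rightarrow> 'v::real_vector set) \<Rightarrow> (nat \<Rightarrow>\<^sub>0 'v) set" where
  "direct_sum_space n W =
     {x. (\<forall>i<n. Poly_Mapping.lookup x i \<in> W i) \<and> (\<forall>i\<ge>n. Poly_Mapping.lookup x i = 0)}"

definition direct_sum_mult ::
    "nat \<Rightarrow> (nat \<Rightarrow> 'v \<Rightarrow> 'v \<Rightarrow> 'v::real_vector) \<Rightarrow> (nat \<Rightarrow>\<^sub>0 'v) \<Rightarrow> (nat \<Rightarrow>\<^sub>0 'v) \<Rightarrow> (nat \<Rightarrow>\<^sub>0 'v)" where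
  "direct_sum_mult n mul x y =
     (\<Sum>i<n. Poly_Mapping.single i (mul i (Poly_Mapping.lookup x i) (Poly_Mapping.lookup y i)))"

definition internal_direct_sum ::
    "'v::real_vector set \<Rightarrow> ('v \<Rightarrow> 'v \<Rightarrow> 'v) \<Rightarrow> 'i set \<Rightarrow> ('i \<Rightarrow> 'v set) \<Rightarrow> bool" where
  "internal_direct_sum V mul I W \<longleftrightarrow>
     finite I \<and>
     (\<forall>i\<in>I. subspace (W i) \<and> W i \<subseteq> V) \<and>
     (\<forall>x\<in>V. \<exists>!f. f \<in> (\<Pi>\<^sub>E i\<in>I. W i) \<and> x = (\<Sum>i\<in>I. f i)) \<and>
     (\<forall>i\<in>I. \<forall>x\<in>W i. \<forall>y\<in>W i. mul x y \<in> W i) \<and>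
     (\<forall>i\<in>I. \<forall>j\<in>I. i \<noteq> j \<longrightarrow> (\<forall>x\<in>W i. \<forall>y\<in>W j. mul x y = 0))"

section \<open>Quivers and their path algebras\<close>

text \<open>
  A quiver is a directed multigraph. A path is the list of its arrows, in the order in which they
  are traversed: \<open>pre_digraph.awalk Q u p v\<close> says that \<open>p\<close> is a path with starting vertex \<open>u\<close> and
  terminal vertex \<open>v\<close>.
\<close>

definition finite_acyclic_quiver :: "('a, 'b) pre_digraph \<Rightarrow> bool" where
  "finite_acyclic_quiver Q \<longleftrightarrow>
     fin_digraph Q \<and> \<not> (\<exists>u p. p \<noteq> [] \<and> pre_digraph.awalk Q u p u)"

definition quiver_paths :: "('a, 'b) pre_digraph \<Rightarrow> 'b list set" where
  "quiver_paths Q = {p. p \<noteq> [] \<and> (\<exists>u v. pre_digraph.awalk Q u p v)}"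

definition path_concat :: "('a, 'b) pre_digraph \<Rightarrow> 'b list \<Rightarrow> 'b list \<Rightarrow> 'b list option" where
  "path_concat Q p q = (if p @ q \<in> quiver_paths Q then Some (p @ q) else None)"

definition path_algebra :: "('a, 'b) pre_digraph \<Rightarrow> ('b list \<Rightarrow>\<^sub>0 real) set" where
  "path_algebra Q = free_space (quiver_paths Q)"

definition path_algebra_mult ::
    "('a, 'b) pre_digraph \<Rightarrow> ('b list \<Rightarrow>\<^sub>0 real) \<Rightarrow> ('b list \<Rightarrow>\<^sub>0 real) \<Rightarrow> ('b list \<Rightarrow>\<^sub>0 real)" where
  "path_algebra_mult Q = basis_mult (path_concat Q)"

text \<open>
  The summands range over all finite acyclic quivers. Each of these is isomorphic to one whose
  vertices and arrows are natural numbers, so no generality is lost by fixing these types.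
\<close>

definition algebraically_connected :: "('a, 'b) pre_digraph \<Rightarrow> bool" where
  "algebraically_connected Q \<longleftrightarrow>
     finite_acyclic_quiver Q \<and>
     \<not> (\<exists>(n::nat) (F :: nat \<Rightarrow> (nat, nat) pre_digraph).
          2 \<le> n \<and>
          (\<forall>i<n. finite_acyclic_quiver (F i) \<and> path_algebra (F i) \<noteq> {0}) \<and>
          algebras_isomorphic
            (path_algebra Q) (path_algebra_mult Q)
            (direct_sum_space n (\<lambda>i. path_algebra (F i)))
            (direct_sum_mult n (\<lambda>i. path_algebra_mult (F i))))"

definition algebraic_decomposition ::
    "('a, 'b) pre_digraph \<Rightarrow> ('a, 'b) pre_digraph set \<Rightarrow> bool" where
  "algebraic_decomposition Q \<E> \<longleftrightarrow>
     (\<forall>E\<in>\<E>. subgraph E Q \<and> arcs E \<noteq> {} \<and>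
        (\<forall>v\<in>verts E. \<exists>a\<in>arcs E. v = tail E a \<or> v = head E a) \<and>
        algebraically_connected E) \<and>
     internal_direct_sum (path_algebra Q) (path_algebra_mult Q) \<E> path_algebra"

text \<open>
  A finite acyclic quiver has exactly one algebraic decomposition; its members are the
  algebraically connected components.
\<close>

definition algebraic_components :: "('a, 'b) pre_digraph \<Rightarrow> ('a, 'b) pre_digraph set" where
  "algebraic_components Q = {E. \<exists>\<E>. algebraic_decomposition Q \<E> \<and> E \<in> \<E>}"

section \<open>Transitively and antisymmetrically ordered sets\<close>

definition taos :: "'a set \<Rightarrow> 'a rel \<Rightarrow> bool" where
  "taos P r \<longleftrightarrow> r \<subseteq> P \<times> P \<and> trans r \<and> antisym r"

definition taos_basis :: "'a set \<Rightarrow> 'a rel \<Rightarrow> ('a \<times> 'a) set" where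
  "taos_basis P r = {(s, t). s \<in> P \<and> t \<in> P \<and> (s, t) \<in> r} - {(u, u) | u. u \<in> P \<and> (u, u) \<in> r}"

definition taos_algebra :: "'a set \<Rightarrow> 'a rel \<Rightarrow> ('a \<times> 'a \<Rightarrow>\<^sub>0 real) set" where
  "taos_algebra P r = free_space (taos_basis P r)"

definition taos_mult ::
    "('a \<times> 'a \<Rightarrow>\<^sub>0 real) \<Rightarrow> ('a \<times> 'a \<Rightarrow>\<^sub>0 real) \<Rightarrow> ('a \<times> 'a \<Rightarrow>\<^sub>0 real)" where
  "taos_mult = basis_mult (\<lambda>(s, t) (u, v). if t = u then Some (s, v) else None)"

definition taos_bracket ::
    "('a \<times> 'a \<Rightarrow>\<^sub>0 real) \<Rightarrow> ('a \<times> 'a \<Rightarrow>\<^sub>0 real) \<Rightarrow> ('a \<times> 'a \<Rightarrow>\<^sub>0 real)" where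
  "taos_bracket x y = taos_mult x y - taos_mult y x"

definition hasse_quiver :: "'a set \<Rightarrow> 'a rel \<Rightarrow> ('a, 'a \<times> 'a) pre_digraph" where
  "hasse_quiver P r =
     \<lparr> verts = P,
       arcs = {(a, b). a \<in> P \<and> b \<in> P \<and> (a, b) \<in> r \<and> a \<noteq> b \<and>
                 \<not> (\<exists>t\<in>P - {a, b}. (a, t) \<in> r \<and> (t, b) \<in> r)},
       tail = fst,
       head = snd \<rparr>"

text \<open>
  \<open>C i\<close> is the \<open>i\<close>-th column and, for \<open>i \<ge> 2\<close>, \<open>M i\<close> is the set of its chosen elements. The numbers
  \<open>n i\<close> are positive, hence the columns are finite and nonempty.
\<close>

definition array_taos :: "'a set \<Rightarrow> 'a rel \<Rightarrow> bool" where
  "array_taos P r \<longleftrightarrow>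
     (\<exists>(k::nat) (n::nat \<Rightarrow> nat) (m::nat \<Rightarrow> nat) (C::nat \<Rightarrow> 'a set) (M::nat \<Rightarrow> 'a set).
        2 \<le> k \<and>
        (\<forall>i\<in>{1..k}. 1 \<le> n i \<and> 1 \<le> m i \<and> m i \<le> n i) \<and>
        m 1 = n 1 \<and> m k = n k \<and>
        P = (\<Union>i\<in>{1..k}. C i) \<and> disjoint_family_on C {1..k} \<and>
        (\<forall>i\<in>{1..k}. card (C i) = n i) \<and>
        (\<forall>i\<in>{1..<k}. M (Suc i) \<subseteq> C (Suc i) \<and> card (M (Suc i)) = m (Suc i)) \<and>
        r = (\<Union>i\<in>{1..<k}. C i \<times> M (Suc i))\<^sup>+)"

end

theory Submission
  imports Defs
begin

text \<open>
  Call two arrows of the Hasse quiver adjacent if one ends where the other one starts. The classes of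
  the generated equivalence relation are the algebraically connected components. A vertex with
  incoming and outgoing arrows meets only one of them, so by the array hypothesis the elements
  between \<open>s\<close> and \<open>v\<close>, for \<open>s \<prec> t \<prec> v\<close>, are those between \<open>s\<close> and \<open>t\<close>, those between \<open>t\<close> and \<open>v\<close>, and
  those in the column of \<open>t\<close>; the hypothesis on parallel paths keeps other components from
  contributing. For the inner product in which the basis vectors \<open>(s, v)\<close> are orthogonal with squared
  length \<open>q v\<close>, the Ricci operator is diagonal, with eigenvalues
  \<open>1/2 (\<Sum> 1 / q t - |{u. v \<prec> u}| / q v - |{u. u \<prec> s}| / q s)\<close>, where the sum ranges over \<open>s \<prec> t \<prec> v\<close>. A
  diagonal operator is a derivation iff its eigenvalues are additive along \<open>s \<prec> t \<prec> v\<close>, and for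
  \<open>Ric + id\<close> this holds if \<open>2 q t\<close> is the number of elements below \<open>t\<close>, above \<open>t\<close>, or in the column of \<open>t\<close>.
\<close>

section \<open>The Ricci operator of a unimodular metric Lie algebra\<close>

text \<open>Additivity along \<open>s\<close>, \<open>t\<close>, \<open>v\<close> looks like a
  system coupling the values of \<open>q\<close> on a whole interval, but it decouples. The boundary
  terms of the eigenvalues at \<open>s\<close> and \<open>v\<close>, and the sums over the points
  between \<open>s\<close> and \<open>t\<close> and between \<open>t\<close> and \<open>v\<close>,
  occur on both sides. What remains is that the sum of \<open>1 / q x\<close> over the chosen
  elements \<open>x\<close> in the column of \<open>t\<close>, plus the boundary terms
  \<open>card (pred t) / q t\<close> and \<open>card (succ t) / q t\<close>, equals 2, which is the
  constant 1 of \<open>Ric + id\<close> divided by the factor 1/2 of the eigenvalues. These elements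
  share predecessors and successors, so \<open>q\<close> can be constant on them, and the equation
  is solved for \<open>q t\<close>. Two obstacles precede this. Curvature is given by a description
  and a chosen basis, so Ricci must first be expressed by structure constants; strict triangularity
  then removes its trace and Killing terms. Components are defined by isomorphisms with arbitrary
  direct sums; the handle on these is that an arrow, unlike a longer path, is no combination of
  products.\<close>

lemma linear_on_sum:
  assumes "subspace V" "linear_on V f" "\<And>i. i \<in> I \<Longrightarrow> g i \<in> V"
  shows "f (\<Sum>i\<in>I. g i) = (\<Sum>i\<in>I. f (g i))"
proof -
  have f0: "f 0 = 0"
    using assms(2) subspace_0[OF assms(1)] unfolding linear_on_def
    by (metis scale_zero_left)
  show ?thesis
    using assms(3)
  proof (induction I rule: infinite_finite_induct)
    case (insert x F)
    then show ?case
      using assms(2) subspace_sum[OF assms(1), of F g] by (simp add: linear_on_def)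
  qed (use f0 in auto)
qed

lemma bilinear_on_sum_sum:
  assumes "subspace V" "bilinear_on V f" "\<And>i. i \<in> I \<Longrightarrow> g i \<in> V" "\<And>j. j \<in> J \<Longrightarrow> h j \<in> V"
  shows "f (\<Sum>i\<in>I. a i *\<^sub>R g i) (\<Sum>j\<in>J. b j *\<^sub>R h j)
       = (\<Sum>i\<in>I. \<Sum>j\<in>J. (a i * b j) *\<^sub>R f (g i) (h j))"
proof -
  have in1: "a i *\<^sub>R g i \<in> V" if "i \<in> I" for i using that assms subspace_scale by blast
  have in2: "b j *\<^sub>R h j \<in> V" if "j \<in> J" for j using that assms subspace_scale by blast
  have s2: "(\<Sum>j\<in>J. b j *\<^sub>R h j) \<in> V" using in2 by (rule subspace_sum[OF assms(1)])
  have "f (\<Sum>i\<in>I. a i *\<^sub>R g i) (\<Sum>j\<in>J. b j *\<^sub>R h j)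
      = (\<Sum>i\<in>I. f (a i *\<^sub>R g i) (\<Sum>j\<in>J. b j *\<^sub>R h j))"
    using linear_on_sum[OF assms(1), of "\<lambda>x. f x (\<Sum>j\<in>J. b j *\<^sub>R h j)" I "\<lambda>i. a i *\<^sub>R g i"]
      assms(2) s2 in1 by (simp add: bilinear_on_def)
  also have "\<dots> = (\<Sum>i\<in>I. a i *\<^sub>R f (g i) (\<Sum>j\<in>J. b j *\<^sub>R h j))"
    using assms(2,3) s2 by (intro sum.cong) (auto simp: bilinear_on_def linear_on_def)
  also have "\<dots> = (\<Sum>i\<in>I. a i *\<^sub>R (\<Sum>j\<in>J. f (g i) (b j *\<^sub>R h j)))"
    using linear_on_sum[OF assms(1), of _ J "\<lambda>j. b j *\<^sub>R h j"] assms(2,3) in2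
    by (intro sum.cong) (auto simp: bilinear_on_def)
  also have "\<dots> = (\<Sum>i\<in>I. a i *\<^sub>R (\<Sum>j\<in>J. b j *\<^sub>R f (g i) (h j)))"
    using assms(2,3,4) by (intro sum.cong arg_cong2[where f=scaleR]) (auto simp: bilinear_on_def linear_on_def)
  finally show ?thesis by (simp add: scaleR_sum_right)
qed

section \<open>Orthonormal bases of a metric Lie algebra\<close>

locale metric_lie =
  fixes V :: "'v::real_vector set" and br :: "'v \<Rightarrow> 'v \<Rightarrow> 'v" and ip :: "'v \<Rightarrow> 'v \<Rightarrow> real"
  assumes mla: "metric_lie_algebra V br ip"
begin

lemma sub: "subspace V" and bil_br: "bilinear_on V br" and bil_ip: "bilinear_on V ip"
  and br_closed: "x \<in> V \<Longrightarrow> y \<in> V \<Longrightarrow> br x y \<in> V"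
  and ip_sym: "x \<in> V \<Longrightarrow> y \<in> V \<Longrightarrow> ip x y = ip y x"
  using mla by (auto simp: metric_lie_algebra_def lie_algebra_on_def inner_product_on_def)

lemma closed [simp, intro]: "0 \<in> V" "x \<in> V \<Longrightarrow> y \<in> V \<Longrightarrow> x + y \<in> V"
  "x \<in> V \<Longrightarrow> y \<in> V \<Longrightarrow> x - y \<in> V" "x \<in> V \<Longrightarrow> c *\<^sub>R x \<in> V" "x \<in> V \<Longrightarrow> - x \<in> V"
  using sub by (auto simp: subspace_0 subspace_add subspace_diff subspace_scale subspace_neg)

lemma br_linear:
  "x \<in> V \<Longrightarrow> y \<in> V \<Longrightarrow> z \<in> V \<Longrightarrow> br (x + y) z = br x z + br y z"
  "x \<in> V \<Longrightarrow> y \<in> V \<Longrightarrow> z \<in> V \<Longrightarrow> br x (y + z) = br x y + br x z"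
  "x \<in> V \<Longrightarrow> y \<in> V \<Longrightarrow> br (c *\<^sub>R x) y = c *\<^sub>R br x y"
  "x \<in> V \<Longrightarrow> y \<in> V \<Longrightarrow> br x (c *\<^sub>R y) = c *\<^sub>R br x y"
  using bil_br by (auto simp: bilinear_on_def linear_on_def)

lemma ip_linear:
  "x \<in> V \<Longrightarrow> y \<in> V \<Longrightarrow> z \<in> V \<Longrightarrow> ip (x + y) z = ip x z + ip y z"
  "x \<in> V \<Longrightarrow> y \<in> V \<Longrightarrow> z \<in> V \<Longrightarrow> ip x (y + z) = ip x y + ip x z"
  "x \<in> V \<Longrightarrow> y \<in> V \<Longrightarrow> ip (c *\<^sub>R x) y = c * ip x y"
  "x \<in> V \<Longrightarrow> y \<in> V \<Longrightarrow> ip x (c *\<^sub>R y) = c * ip x y"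
  using bil_ip by (auto simp: bilinear_on_def linear_on_def)

lemma ip_minus:
  assumes "x \<in> V" "y \<in> V" shows "ip (- x) y = - ip x y" "ip x (- y) = - ip x y"
  using ip_linear(3,4)[of x y "-1"] assms by auto

lemma ip_diff:
  assumes "x \<in> V" "y \<in> V" "z \<in> V" shows "ip (x - y) z = ip x z - ip y z"
  using ip_linear(1)[of x "- y" z] assms by (simp add: ip_minus)

lemma ip_sum:
  assumes "y \<in> V" "\<And>i. i \<in> I \<Longrightarrow> g i \<in> V"
  shows "ip (\<Sum>i\<in>I. g i) y = (\<Sum>i\<in>I. ip (g i) y)"
  using linear_on_sum[OF sub, of "\<lambda>x. ip x y" I g] bil_ip assms by (auto simp: bilinear_on_def)

lemma br_skew:
  assumes "x \<in> V" "y \<in> V" shows "br y x = - br x y"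
proof -
  have alt: "br z z = 0" if "z \<in> V" for z
    using mla that by (auto simp: metric_lie_algebra_def lie_algebra_on_def)
  have "0 = br (x + y) (x + y)" using alt assms by simp
  also have "\<dots> = br x y + br y x" using assms alt[of x] alt[of y] by (simp add: br_linear)
  finally show ?thesis by (metis add_eq_0_iff)
qed

lemma orthonormal_subset:
  "orthonormal_basis V ip S \<Longrightarrow> e \<in> S \<Longrightarrow> e \<in> V"
  by (auto simp: orthonormal_basis_def span_base)

lemma orthonormal_expansion:
  assumes S: "orthonormal_basis V ip S" and x: "x \<in> V"
  shows "x = (\<Sum>e\<in>S. ip x e *\<^sub>R e)"
proof -
  have fin: "finite S" and sp: "span S = V"
    and on: "\<And>x y. x \<in> S \<Longrightarrow> y \<in> S \<Longrightarrow> ip x y = (if x = y then 1 else 0)"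
    using S by (auto simp: orthonormal_basis_def)
  obtain u where u: "x = (\<Sum>e\<in>S. u e *\<^sub>R e)"
    using x sp span_finite[OF fin] by auto
  have "ip x e = u e" if e: "e \<in> S" for e
  proof -
    have eV: "e \<in> V" using S e by (rule orthonormal_subset)
    have "ip x e = (\<Sum>g\<in>S. ip (u g *\<^sub>R g) e)"
      unfolding u by (rule ip_sum[OF eV]) (use orthonormal_subset[OF S] in blast)
    also have "\<dots> = (\<Sum>g\<in>S. if g = e then u e else 0)"
      using orthonormal_subset[OF S] eV
      by (intro sum.cong) (auto simp: ip_linear(3) on e)
    finally show ?thesis using fin e by simp
  qed
  then show ?thesis using u by simp
qed

lemma parseval:
  assumes S: "orthonormal_basis V ip S" and "x \<in> V" "y \<in> V"
  shows "ip x y = (\<Sum>e\<in>S. ip x e * ip y e)"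
proof -
  have "ip x y = ip (\<Sum>e\<in>S. ip x e *\<^sub>R e) y"
    using orthonormal_expansion[OF S assms(2)] by simp
  also have "\<dots> = (\<Sum>e\<in>S. ip (ip x e *\<^sub>R e) y)"
    by (rule ip_sum[OF assms(3)]) (use orthonormal_subset[OF S] in blast)
  also have "\<dots> = (\<Sum>e\<in>S. ip x e * ip y e)"
    using orthonormal_subset[OF S] assms
    by (intro sum.cong) (auto simp: ip_linear ip_sym)
  finally show ?thesis .
qed

text \<open>\<open>ricci\<close> sums over a basis picked by \<open>SOME\<close>; this allows
  passing to an explicit one. Expanding both arguments of \<open>T\<close> in \<open>S'\<close> and
  summing over \<open>S\<close> leaves, by Parseval, the inner products of the elements of
  \<open>S'\<close>.\<close>

lemma trace_independent:
  fixes T :: "'v \<Rightarrow> 'v \<Rightarrow> real"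
  assumes S: "orthonormal_basis V ip S" and S': "orthonormal_basis V ip S'"
    and T: "bilinear_on V T"
  shows "(\<Sum>e\<in>S. T e e) = (\<Sum>e\<in>S'. T e e)"
proof -
  have fin: "finite S'" and on: "\<And>x y. x \<in> S' \<Longrightarrow> y \<in> S' \<Longrightarrow> ip x y = (if x = y then 1 else 0)"
    using S' by (auto simp: orthonormal_basis_def)
  have "(\<Sum>e\<in>S. T e e) = (\<Sum>e\<in>S. \<Sum>g\<in>S'. \<Sum>h\<in>S'. ip e g * ip e h * T g h)"
  proof (intro sum.cong refl)
    fix e assume "e \<in> S"
    then have eV: "e \<in> V" using S orthonormal_subset by blast
    have "T e e = T (\<Sum>g\<in>S'. ip e g *\<^sub>R g) (\<Sum>g\<in>S'. ip e g *\<^sub>R g)"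
      using orthonormal_expansion[OF S' eV] by simp
    then show "T e e = (\<Sum>g\<in>S'. \<Sum>h\<in>S'. ip e g * ip e h * T g h)"
      using bilinear_on_sum_sum[OF sub T, of S' "\<lambda>g. g" S' "\<lambda>g. g" "ip e" "ip e"]
        orthonormal_subset[OF S'] by simp
  qed
  also have "\<dots> = (\<Sum>g\<in>S'. \<Sum>e\<in>S. \<Sum>h\<in>S'. ip e g * ip e h * T g h)"
    by (rule sum.swap)
  also have "\<dots> = (\<Sum>g\<in>S'. \<Sum>h\<in>S'. \<Sum>e\<in>S. ip e g * ip e h * T g h)"
    by (intro sum.cong refl sum.swap)
  also have "\<dots> = (\<Sum>g\<in>S'. \<Sum>h\<in>S'. if h = g then T g h else 0)"
  proof (intro sum.cong refl)
    fix g h assume gh: "g \<in> S'" "h \<in> S'"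
    then have V: "g \<in> V" "h \<in> V" using S' orthonormal_subset by blast+
    have "(\<Sum>e\<in>S. ip e g * ip e h * T g h) = (\<Sum>e\<in>S. ip g e * ip h e) * T g h"
      unfolding sum_distrib_right
      using V orthonormal_subset[OF S] by (intro sum.cong) (auto simp: ip_sym)
    also have "\<dots> = ip g h * T g h" using parseval[OF S V] by simp
    finally show "(\<Sum>e\<in>S. ip e g * ip e h * T g h) = (if h = g then T g h else 0)"
      using on gh by auto
  qed
  also have "\<dots> = (\<Sum>e\<in>S'. T e e)" using fin by simp
  finally show ?thesis .
qed

section \<open>Levi-Civita connection and Ricci form\<close>

definition koszul :: "'v \<Rightarrow> 'v \<Rightarrow> 'v \<Rightarrow> real" where
  "koszul X Y Z = ip (br X Y) Z + ip (br Z X) Y + ip X (br Z Y)"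

lemma koszul_linear:
  assumes "X \<in> V" "Y \<in> V" "Z \<in> V"
  shows "W \<in> V \<Longrightarrow> koszul (X + W) Y Z = koszul X Y Z + koszul W Y Z"
    "W \<in> V \<Longrightarrow> koszul X (Y + W) Z = koszul X Y Z + koszul X W Z"
    "W \<in> V \<Longrightarrow> koszul X Y (Z + W) = koszul X Y Z + koszul X Y W"
    "koszul (c *\<^sub>R X) Y Z = c * koszul X Y Z"
    "koszul X (c *\<^sub>R Y) Z = c * koszul X Y Z"
    "koszul X Y (c *\<^sub>R Z) = c * koszul X Y Z"
  unfolding koszul_def using assms by (simp_all add: br_linear ip_linear br_closed algebra_simps)

context
  fixes S assumes S: "orthonormal_basis V ip S"
begin

lemma eq_if_ip_eq:
  assumes "x \<in> V" "y \<in> V" "\<And>e. e \<in> S \<Longrightarrow> ip x e = ip y e"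
  shows "x = y"
  using orthonormal_expansion[OF S assms(1)] orthonormal_expansion[OF S assms(2)] assms(3)
  by simp

lemma levi_civita:
  assumes "X \<in> V" "Y \<in> V"
  shows "levi_civita V br ip X Y \<in> V"
    and "Z \<in> V \<Longrightarrow> 2 * ip (levi_civita V br ip X Y) Z = koszul X Y Z"
proof -
  \<comment> \<open>The Riesz representative of half of \<open>koszul X Y\<close>, written in the
    basis \<open>S\<close>. It is a witness for the description in \<open>levi_civita\<close>;
    comparing coordinates gives uniqueness.\<close>
  define W where "W = (\<Sum>e\<in>S. (koszul X Y e / 2) *\<^sub>R e)"
  have WV: "W \<in> V"
    unfolding W_def by (rule subspace_sum[OF sub]) (use orthonormal_subset[OF S] in blast)
  have W: "2 * ip W Z = koszul X Y Z" if Z: "Z \<in> V" for Z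
  proof -
    have lin: "linear_on V (koszul X Y)"
      using koszul_linear assms unfolding linear_on_def by simp
    have "2 * ip W Z = (\<Sum>e\<in>S. koszul X Y e * ip e Z)"
      unfolding W_def using orthonormal_subset[OF S] Z
      by (subst ip_sum) (auto simp: ip_linear sum_distrib_left)
    also have "\<dots> = (\<Sum>e\<in>S. koszul X Y (ip Z e *\<^sub>R e))"
      using orthonormal_subset[OF S] Z assms
      by (intro sum.cong) (auto simp: koszul_linear ip_sym)
    also have "\<dots> = koszul X Y (\<Sum>e\<in>S. ip Z e *\<^sub>R e)"
      by (rule linear_on_sum[OF sub lin, symmetric]) (use orthonormal_subset[OF S] in blast)
    finally show ?thesis using orthonormal_expansion[OF S Z] by simp
  qed
  have "levi_civita V br ip X Y = W"
    unfolding levi_civita_def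
  proof (rule the_equality)
    show "W \<in> V \<and> (\<forall>Z\<in>V. 2 * ip W Z = ip (br X Y) Z + ip (br Z X) Y + ip X (br Z Y))"
      using W WV by (simp add: koszul_def)
    fix W' assume W': "W' \<in> V \<and>
      (\<forall>Z\<in>V. 2 * ip W' Z = ip (br X Y) Z + ip (br Z X) Y + ip X (br Z Y))"
    then have "ip W' e = ip W e" if "e \<in> S" for e
      using W[of e] W' orthonormal_subset[OF S that] by (auto simp: koszul_def)
    with W' WV show "W' = W" by (intro eq_if_ip_eq) auto
  qed
  then show "levi_civita V br ip X Y \<in> V"
    and "Z \<in> V \<Longrightarrow> 2 * ip (levi_civita V br ip X Y) Z = koszul X Y Z"
    using W WV by auto
qed

abbreviation conn where "conn \<equiv> levi_civita V br ip"

lemma conn_linear: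
  assumes "X \<in> V" "Y \<in> V"
  shows "W \<in> V \<Longrightarrow> conn (X + W) Y = conn X Y + conn W Y"
    "W \<in> V \<Longrightarrow> conn X (Y + W) = conn X Y + conn X W"
    "conn (c *\<^sub>R X) Y = c *\<^sub>R conn X Y" "conn X (c *\<^sub>R Y) = c *\<^sub>R conn X Y"
proof -
  have half: "ip (conn A B) e = koszul A B e / 2" if "A \<in> V" "B \<in> V" "e \<in> S" for A B e
    using levi_civita(2)[of A B e] orthonormal_subset[OF S] that by simp
  note [simp] = half levi_civita(1) ip_linear orthonormal_subset[OF S] koszul_linear assms
  show "conn (X + W) Y = conn X Y + conn W Y" if [simp]: "W \<in> V"
    by (rule eq_if_ip_eq) (simp_all add: add_divide_distrib)
  show "conn X (Y + W) = conn X Y + conn X W" if [simp]: "W \<in> V"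
    by (rule eq_if_ip_eq) (simp_all add: add_divide_distrib)
  show "conn (c *\<^sub>R X) Y = c *\<^sub>R conn X Y"
    by (rule eq_if_ip_eq) simp_all
  show "conn X (c *\<^sub>R Y) = c *\<^sub>R conn X Y"
    by (rule eq_if_ip_eq) simp_all
qed

text \<open>Metric compatibility: in the sum of the two Koszul expressions with \<open>Y\<close> and
  \<open>Z\<close> exchanged, the six terms cancel in pairs because \<open>br\<close> is
  skew.\<close>

lemma conn_metric:
  assumes "X \<in> V" "Y \<in> V" "Z \<in> V"
  shows "ip (conn X Y) Z = - ip Y (conn X Z)"
proof -
  have "2 * ip (conn X Y) Z + 2 * ip (conn X Z) Y = 0"
    using assms br_skew[of X Z] br_skew[of Y X] br_skew[of Z Y] br_skew[of X Y] br_skew[of Y Z]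
    by (simp add: levi_civita(2) koszul_def ip_minus br_closed)
  then show ?thesis using assms ip_sym[of Y "conn X Z"] by (simp add: levi_civita(1))
qed

lemma curvature_linear:
  assumes "X \<in> V" "Y \<in> V" "Z \<in> V"
  shows "W \<in> V \<Longrightarrow> curvature V br ip X (Y + W) Z = curvature V br ip X Y Z + curvature V br ip X W Z"
    "W \<in> V \<Longrightarrow> curvature V br ip X Y (Z + W) = curvature V br ip X Y Z + curvature V br ip X Y W"
    "curvature V br ip X (c *\<^sub>R Y) Z = c *\<^sub>R curvature V br ip X Y Z"
    "curvature V br ip X Y (c *\<^sub>R Z) = c *\<^sub>R curvature V br ip X Y Z"
  unfolding curvature_def using assms
  by (simp_all add: conn_linear br_linear br_closed levi_civita(1) algebra_simps)

lemma curvature_closed: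
  "X \<in> V \<Longrightarrow> Y \<in> V \<Longrightarrow> Z \<in> V \<Longrightarrow> curvature V br ip X Y Z \<in> V"
  unfolding curvature_def by (simp add: br_closed levi_civita(1))

lemma chosen_basis: "orthonormal_basis V ip (SOME B. orthonormal_basis V ip B)"
  using S by (rule someI)

lemma ricci_closed: "X \<in> V \<Longrightarrow> ricci V br ip X \<in> V"
  unfolding ricci_def
  by (rule subspace_sum[OF sub]) (use curvature_closed orthonormal_subset[OF chosen_basis] in blast)

lemma ip_ricci_trace:
  assumes "X \<in> V" "Y \<in> V"
  shows "ip (ricci V br ip X) Y = (\<Sum>e\<in>S. ip (curvature V br ip X e e) Y)"
proof -
  let ?B = "SOME B. orthonormal_basis V ip B"
  have "ip (ricci V br ip X) Y = (\<Sum>e\<in>?B. ip (curvature V br ip X e e) Y)"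
    unfolding ricci_def
    by (rule ip_sum[OF assms(2)]) (use curvature_closed assms orthonormal_subset[OF chosen_basis] in blast)
  also have "\<dots> = (\<Sum>e\<in>S. ip (curvature V br ip X e e) Y)"
    by (rule trace_independent[OF chosen_basis S])
       (use assms in \<open>simp add: bilinear_on_def linear_on_def curvature_linear curvature_closed ip_linear\<close>)
  finally show ?thesis .
qed

text \<open>The classical Ricci formula for unimodular metric Lie algebras. The last double sum is
  the Killing form, the trace of the product of the adjoint maps of \<open>X\<close> and
  \<open>Y\<close>.\<close>

lemma ip_ricci:
  assumes XY: "X \<in> V" "Y \<in> V"
    and unimodular: "\<And>Z. Z \<in> V \<Longrightarrow> (\<Sum>e\<in>S. ip (br Z e) e) = 0"
  shows "ip (ricci V br ip X) Y =
      (\<Sum>e\<in>S. \<Sum>f\<in>S. ip (br e f) X * ip (br e f) Y) / 4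
      - (\<Sum>e\<in>S. \<Sum>f\<in>S. ip (br X e) f * ip (br Y e) f) / 2
      - (\<Sum>e\<in>S. \<Sum>f\<in>S. ip (br X e) f * ip (br Y f) e) / 2"
proof -
  define x where "x e f = ip (br X e) f" for e f
  define y where "y e f = ip (br Y e) f" for e f
  define p where "p e f = ip (br e f) X" for e f
  define r where "r e f = ip (br e f) Y" for e f
  have eV: "e \<in> V" if "e \<in> S" for e using orthonormal_subset[OF S that] .
  \<comment> \<open>\<open>conn_metric\<close> moves the outer derivative of each of the three terms
    of the curvature onto \<open>Y\<close>. The second is then expanded by Parseval, the third by
    writing \<open>br X e\<close> in the basis \<open>S\<close>.\<close>
  have curv: "ip (curvature V br ip X e e) Y =
      (\<Sum>f\<in>S. ip (conn X e) f * ip (conn e Y) f)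
      + (\<Sum>f\<in>S. x e f * ip (conn f Y) e) - ip (conn e e) (conn X Y)" if e: "e \<in> S" for e
  proof -
    have "ip (curvature V br ip X e e) Y =
        ip (conn X (conn e e)) Y - ip (conn e (conn X e)) Y - ip (conn (br X e) e) Y"
      unfolding curvature_def using XY eV[OF e]
      by (simp add: ip_diff levi_civita(1) br_closed)
    also have "\<dots> = - ip (conn e e) (conn X Y) + ip (conn X e) (conn e Y)
        + ip e (conn (br X e) Y)"
      using XY eV[OF e] by (simp add: conn_metric levi_civita(1) br_closed)
    also have "ip (conn X e) (conn e Y) = (\<Sum>f\<in>S. ip (conn X e) f * ip (conn e Y) f)"
      using XY eV[OF e] by (intro parseval[OF S]) (simp_all add: levi_civita(1))
    also have "ip e (conn (br X e) Y) = (\<Sum>f\<in>S. x e f * ip (conn f Y) e)"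
    proof -
      have lin: "linear_on V (\<lambda>Z. ip (conn Z Y) e)"
        unfolding linear_on_def using XY eV[OF e]
        by (simp add: conn_linear ip_linear levi_civita(1))
      have "ip e (conn (br X e) Y) = ip (conn (br X e) Y) e"
        using XY eV[OF e] by (intro ip_sym) (simp_all add: levi_civita(1) br_closed)
      also have "\<dots> = ip (conn (\<Sum>f\<in>S. ip (br X e) f *\<^sub>R f) Y) e"
        using orthonormal_expansion[OF S, of "br X e"] XY eV[OF e] by (simp add: br_closed)
      also have "\<dots> = (\<Sum>f\<in>S. ip (conn (ip (br X e) f *\<^sub>R f) Y) e)"
        by (rule linear_on_sum[OF sub lin]) (use eV in blast)
      finally show ?thesis
        using XY eV e by (simp add: x_def conn_linear ip_linear levi_civita(1))
    qed
    finally show ?thesis by simp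
  qed
  \<comment> \<open>By the Koszul formula, pairing \<open>conn e e\<close> with \<open>W\<close>
    gives \<open>ip (br W e) e\<close>. With \<open>W = conn X Y\<close> the sum is the trace of an
    adjoint map, hence zero by unimodularity.\<close>
  have "(\<Sum>e\<in>S. ip (conn e e) (conn X Y)) = (\<Sum>e\<in>S. ip (br (conn X Y) e) e)"
  proof (intro sum.cong refl)
    fix e assume "e \<in> S"
    then have e: "e \<in> V" "conn X Y \<in> V" using eV XY by (simp_all add: levi_civita(1))
    have "br e e = 0" using mla e by (auto simp: metric_lie_algebra_def lie_algebra_on_def)
    moreover have "ip 0 (conn X Y) = 0" using ip_linear(3)[of e "conn X Y" 0] e by simp
    ultimately show "ip (conn e e) (conn X Y) = ip (br (conn X Y) e) e"
      using levi_civita(2)[of e e "conn X Y"] e ip_sym[of e "br (conn X Y) e"]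
      by (simp add: koszul_def br_closed)
  qed
  then have zero: "(\<Sum>e\<in>S. ip (conn e e) (conn X Y)) = 0"
    using unimodular[of "conn X Y"] XY by (simp add: levi_civita(1))
  \<comment> \<open>The unwanted terms of the expansion are \<open>h e f - h f e\<close>, which cancel in the double sum.\<close>
  define h where "h e f = (- x e f * y e f - x e f * y f e + x e f * r e f + p e f * y e f) / 4"
    for e f
  have summand: "ip (conn X e) f * ip (conn e Y) f + x e f * ip (conn f Y) e =
      p e f * r e f / 4 - x e f * y e f / 2 - x e f * y f e / 2 + (h e f - h f e)"
    if ef: "e \<in> S" "f \<in> S" for e f
  proof -
    note V = XY eV[OF ef(1)] eV[OF ef(2)]
    have 1: "ip (conn X e) f = (x e f - x f e - p e f) / 2"
      using levi_civita(2)[of X e f] br_skew[of X f] br_skew[of e f] V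
        ip_sym[of X "br e f"]
      by (simp add: koszul_def x_def p_def ip_minus br_closed)
    have 2: "ip (conn e Y) f = (- y e f - r e f - y f e) / 2"
      using levi_civita(2)[of e Y f] br_skew[of Y e] br_skew[of e f] br_skew[of Y f] V
        ip_sym[of e "br Y f"]
      by (simp add: koszul_def y_def r_def ip_minus br_closed)
    have 3: "ip (conn f Y) e = (- y f e + r e f - y e f) / 2"
      using levi_civita(2)[of f Y e] br_skew[of Y f] br_skew[of Y e] V
        ip_sym[of f "br Y e"]
      by (simp add: koszul_def y_def r_def ip_minus br_closed)
    have 4: "p f e = - p e f" "r f e = - r e f"
      using br_skew[of e f] V by (simp_all add: p_def r_def ip_minus br_closed)
    have alg: "(a - a' - c) / 2 * ((- b - d - b') / 2) + a * ((- b' + d - b) / 2) =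
        c * d / 4 - a * b / 2 - a * b' / 2
        + ((- a * b - a * b' + a * d + c * b) / 4 - (- a' * b' - a' * b + a' * - d + - c * b') / 4)"
      for a a' b b' c d :: real by (simp add: field_simps)
    show ?thesis
      unfolding 1 2 3 h_def \<open>p f e = - p e f\<close> \<open>r f e = - r e f\<close> by (rule alg)
  qed
  have "ip (ricci V br ip X) Y = (\<Sum>e\<in>S. \<Sum>f\<in>S.
      ip (conn X e) f * ip (conn e Y) f + x e f * ip (conn f Y) e)"
    unfolding ip_ricci_trace[OF XY] using curv zero
    by (simp add: sum.distrib sum_subtractf)
  also have "\<dots> = (\<Sum>e\<in>S. \<Sum>f\<in>S. p e f * r e f / 4 - x e f * y e f / 2 - x e f * y f e / 2
      + (h e f - h f e))"
    using summand by (intro sum.cong) auto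
  also have "\<dots> = (\<Sum>e\<in>S. \<Sum>f\<in>S. p e f * r e f) / 4 - (\<Sum>e\<in>S. \<Sum>f\<in>S. x e f * y e f) / 2
      - (\<Sum>e\<in>S. \<Sum>f\<in>S. x e f * y f e) / 2
      + ((\<Sum>e\<in>S. \<Sum>f\<in>S. h e f) - (\<Sum>e\<in>S. \<Sum>f\<in>S. h f e))"
    by (simp add: sum.distrib sum_subtractf sum_divide_distrib)
  also have "(\<Sum>e\<in>S. \<Sum>f\<in>S. h f e) = (\<Sum>e\<in>S. \<Sum>f\<in>S. h e f)"
    by (rule sum.swap)
  finally show ?thesis by (simp add: x_def y_def p_def r_def)
qed

end

end

section \<open>Weighted inner products on the Lie algebra of a TAOS\<close>

abbreviation "lookup \<equiv> Poly_Mapping.lookup"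

lemma lookup_scaleR [simp]: "lookup (c *\<^sub>R x) i = c *\<^sub>R lookup x i"
proof -
  have "finite {i. c *\<^sub>R lookup x i \<noteq> 0}"
    by (rule finite_subset[OF _ finite_lookup[of x]]) auto
  then show ?thesis
    unfolding scaleR_poly_mapping_def by simp
qed

lemma free_space_iff: "x \<in> free_space B \<longleftrightarrow> (\<forall>b. b \<notin> B \<longrightarrow> lookup x b = 0)"
  by (auto simp: free_space_def in_keys_iff)

lemma subspace_free_space: "subspace (free_space B)"
  by (auto simp: subspace_def free_space_iff lookup_add)

lemma free_space_expansion:
  assumes "x \<in> free_space B" "finite B"
  shows "x = (\<Sum>b\<in>B. lookup x b *\<^sub>R Poly_Mapping.single b 1)"
proof (rule poly_mapping_eqI)
  fix k
  have "lookup (\<Sum>b\<in>B. lookup x b *\<^sub>R Poly_Mapping.single b 1) k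
      = (\<Sum>b\<in>B. if b = k then lookup x k else 0)"
    unfolding lookup_sum by (intro sum.cong) (auto simp: lookup_single)
  then show "lookup x k = lookup (\<Sum>b\<in>B. lookup x b *\<^sub>R Poly_Mapping.single b 1) k"
    using assms by (auto simp: free_space_iff)
qed

text \<open>The supports in \<open>basis_mult\<close> vary with the arguments, which hides
  bilinearity. Terms outside of them vanish, so one fixed index set serves all arguments.\<close>

lemma basis_mult_superset:
  assumes "finite B" "Poly_Mapping.keys x \<subseteq> B" "Poly_Mapping.keys y \<subseteq> B"
  shows "basis_mult m x y = (\<Sum>a\<in>B. \<Sum>b\<in>B. case m a b of None \<Rightarrow> 0
      | Some c \<Rightarrow> Poly_Mapping.single c (lookup x a * lookup y b))"
proof -
  define h where "h a b = (case m a b of None \<Rightarrow> 0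
      | Some c \<Rightarrow> Poly_Mapping.single c (lookup x a * lookup y b))" for a b
  have h0: "h a b = 0" if "a \<notin> Poly_Mapping.keys x \<or> b \<notin> Poly_Mapping.keys y" for a b
    using that unfolding h_def by (auto simp: in_keys_iff split: option.split)
  have "basis_mult m x y = (\<Sum>a\<in>Poly_Mapping.keys x. \<Sum>b\<in>Poly_Mapping.keys y. h a b)"
    by (simp add: basis_mult_def h_def)
  also have "\<dots> = (\<Sum>a\<in>Poly_Mapping.keys x. \<Sum>b\<in>B. h a b)"
    using assms h0 by (intro sum.cong sum.mono_neutral_left) auto
  also have "\<dots> = (\<Sum>a\<in>B. \<Sum>b\<in>B. h a b)"
    using assms h0 by (intro sum.mono_neutral_left) (auto intro!: sum.neutral)
  finally show ?thesis by (simp add: h_def)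
qed

lemma lookup_basis_mult:
  assumes "finite B" "Poly_Mapping.keys x \<subseteq> B" "Poly_Mapping.keys y \<subseteq> B"
  shows "lookup (basis_mult m x y) c =
    (\<Sum>a\<in>B. \<Sum>b\<in>B. if m a b = Some c then lookup x a * lookup y b else 0)"
  unfolding basis_mult_superset[OF assms] lookup_sum
  by (intro sum.cong) (auto simp: lookup_single when_def split: option.split)

section \<open>The Lie algebra of a finite TAOS\<close>

locale finite_taos =
  fixes P :: "'a set" and r :: "'a rel"
  assumes finite_P: "finite P" and taos: "taos P r"
begin

abbreviation "B \<equiv> taos_basis P r"
abbreviation "V \<equiv> taos_algebra P r"

lemma B_iff: "(s, t) \<in> B \<longleftrightarrow> (s, t) \<in> r \<and> s \<noteq> t"
  using taos by (auto simp: taos_basis_def taos_def)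

lemma B_subset: "(s, t) \<in> B \<Longrightarrow> s \<in> P \<and> t \<in> P"
  by (auto simp: taos_basis_def)

lemma finite_B: "finite B"
  using finite_P B_subset by (auto intro: finite_subset[of _ "P \<times> P"])

lemma B_irrefl: "(s, s) \<notin> B" by (simp add: B_iff)

lemma B_asym: "(s, t) \<in> B \<Longrightarrow> (t, s) \<notin> B"
  using taos by (auto simp: B_iff taos_def dest: antisymD)

text \<open>Antisymmetry excludes the composite \<open>(s, s)\<close>, which is missing from the
  basis even when it belongs to \<open>r\<close>; this is why products stay in
  \<open>V\<close>.\<close>

lemma B_trans: "(s, t) \<in> B \<Longrightarrow> (t, u) \<in> B \<Longrightarrow> (s, u) \<in> B"
  using taos by (auto simp: B_iff taos_def dest: antisymD transD)

lemma sum_B: "(\<Sum>b\<in>B. f b) = (\<Sum>s\<in>P. \<Sum>t\<in>P. if (s, t) \<in> B then f (s, t) else 0)"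
proof -
  have "(\<Sum>b\<in>B. f b) = (\<Sum>b\<in>P \<times> P. if b \<in> B then f b else 0)"
    using finite_P B_subset by (intro sum.mono_neutral_cong_left) auto
  then show ?thesis by (simp add: sum.cartesian_product split_def cong: if_cong)
qed

lemma V_iff: "x \<in> V \<longleftrightarrow> (\<forall>b. b \<notin> B \<longrightarrow> lookup x b = 0)"
  unfolding taos_algebra_def by (rule free_space_iff)

lemma V_zero: "x \<in> V \<Longrightarrow> b \<notin> B \<Longrightarrow> lookup x b = 0"
  using V_iff by blast

text \<open>Elements of \<open>V\<close> are matrices over \<open>P\<close> supported on
  \<open>B\<close>, and the product is the matrix product. Associativity, and with it the Jacobi
  identity, is inherited from there.\<close>

lemma lookup_mult:
  assumes x: "x \<in> V" and y: "y \<in> V"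
  shows "lookup (taos_mult x y) (s, v) = (\<Sum>t\<in>P. lookup x (s, t) * lookup y (t, v))"
proof -
  have keys: "Poly_Mapping.keys x \<subseteq> P \<times> P" "Poly_Mapping.keys y \<subseteq> P \<times> P"
    using x y B_subset by (auto simp: taos_algebra_def free_space_def)
  have out: "lookup x (s, t) = 0" if "s \<notin> P" for t using V_zero[OF x] B_subset that by blast
  have out': "lookup y (t, v) = 0" if "v \<notin> P" for t using V_zero[OF y] B_subset that by blast
  have "lookup (taos_mult x y) (s, v) = (\<Sum>a\<in>P. \<Sum>b\<in>P. \<Sum>c\<in>P. \<Sum>d\<in>P.
      if b = c \<and> a = s \<and> d = v then lookup x (a, b) * lookup y (c, d) else 0)"
    unfolding taos_mult_def lookup_basis_mult[OF finite_cartesian_product[OF finite_P finite_P] keys]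
    unfolding sum.cartesian_product'
    by (intro sum.cong refl) auto
  also have "\<dots> = (\<Sum>a\<in>P. if a = s then \<Sum>b\<in>P. \<Sum>c\<in>P. if c = b then \<Sum>d\<in>P.
      if d = v then lookup x (a, b) * lookup y (c, d) else 0 else 0 else 0)"
    by (auto intro!: sum.cong sum.neutral)
  also have "\<dots> = (\<Sum>t\<in>P. lookup x (s, t) * lookup y (t, v))"
    using finite_P by (auto simp: out out' intro!: sum.cong)
  finally show ?thesis .
qed

lemma mult_closed:
  assumes x: "x \<in> V" and y: "y \<in> V" shows "taos_mult x y \<in> V"
  unfolding V_iff
proof (intro allI impI)
  fix b assume b: "b \<notin> B"
  obtain s v where sv: "b = (s, v)" by fastforce
  have "lookup x (s, t) * lookup y (t, v) = 0" for t
    using V_zero[OF x, of "(s, t)"] V_zero[OF y, of "(t, v)"] B_trans b sv by auto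
  then have "(\<Sum>t\<in>P. lookup x (s, t) * lookup y (t, v)) = 0" by (intro sum.neutral) blast
  then show "lookup (taos_mult x y) b = 0" by (simp add: sv lookup_mult[OF x y])
qed

lemma subspace_V: "subspace V"
  by (simp add: taos_algebra_def subspace_free_space)

lemma V_closed [simp]: "0 \<in> V" "x \<in> V \<Longrightarrow> y \<in> V \<Longrightarrow> x + y \<in> V"
  "x \<in> V \<Longrightarrow> y \<in> V \<Longrightarrow> x - y \<in> V" "x \<in> V \<Longrightarrow> c *\<^sub>R x \<in> V"
  using subspace_V by (auto simp: subspace_0 subspace_add subspace_diff subspace_scale)

lemma mult_bilinear: "bilinear_on V taos_mult"
  unfolding bilinear_on_def linear_on_def
  by (auto intro!: poly_mapping_eqI
      simp: lookup_mult lookup_add sum.distrib sum_distrib_left algebra_simps split_paired_all)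

lemma mult_assoc:
  assumes V: "x \<in> V" "y \<in> V" "z \<in> V"
  shows "taos_mult (taos_mult x y) z = taos_mult x (taos_mult y z)"
proof (rule poly_mapping_eqI)
  fix b
  obtain s v :: 'a where b: "b = (s, v)" by fastforce
  have "(\<Sum>t\<in>P. (\<Sum>u\<in>P. lookup x (s, u) * lookup y (u, t)) * lookup z (t, v))
      = (\<Sum>u\<in>P. lookup x (s, u) * (\<Sum>t\<in>P. lookup y (u, t) * lookup z (t, v)))"
    unfolding sum_distrib_left sum_distrib_right
    by (subst sum.swap) (simp add: mult.assoc)
  then show "lookup (taos_mult (taos_mult x y) z) b = lookup (taos_mult x (taos_mult y z)) b"
    using V by (simp add: b lookup_mult mult_closed)
qed

lemma lie: "lie_algebra_on V taos_bracket"
proof -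
  have lin: "taos_mult (x + y) z = taos_mult x z + taos_mult y z"
    "taos_mult z (x + y) = taos_mult z x + taos_mult z y"
    "taos_mult (x - y) z = taos_mult x z - taos_mult y z"
    "taos_mult z (x - y) = taos_mult z x - taos_mult z y"
    "taos_mult (c *\<^sub>R x) z = c *\<^sub>R taos_mult x z" "taos_mult z (c *\<^sub>R x) = c *\<^sub>R taos_mult z x"
    if "x \<in> V" "y \<in> V" "z \<in> V" for x y z c
  proof -
    show add: "taos_mult (x + y) z = taos_mult x z + taos_mult y z"
      "taos_mult z (x + y) = taos_mult z x + taos_mult z y"
      "taos_mult (c *\<^sub>R x) z = c *\<^sub>R taos_mult x z" "taos_mult z (c *\<^sub>R x) = c *\<^sub>R taos_mult z x"
      for c using mult_bilinear that by (auto simp: bilinear_on_def linear_on_def)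
    have "taos_mult (- 1 *\<^sub>R y) z = - 1 *\<^sub>R taos_mult y z"
      "taos_mult z (- 1 *\<^sub>R y) = - 1 *\<^sub>R taos_mult z y"
      "taos_mult (x + - 1 *\<^sub>R y) z = taos_mult x z + taos_mult (- 1 *\<^sub>R y) z"
      "taos_mult z (x + - 1 *\<^sub>R y) = taos_mult z x + taos_mult z (- 1 *\<^sub>R y)"
      using mult_bilinear that V_closed(4)[of y "-1"] unfolding bilinear_on_def linear_on_def by blast+
    then show "taos_mult (x - y) z = taos_mult x z - taos_mult y z"
      "taos_mult z (x - y) = taos_mult z x - taos_mult z y" by simp_all
  qed
  have "bilinear_on V taos_bracket"
    unfolding bilinear_on_def linear_on_def taos_bracket_def
    by (auto simp: lin scaleR_diff_right)
  moreover have "taos_bracket x (taos_bracket y z) + taos_bracket y (taos_bracket z x)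
      + taos_bracket z (taos_bracket x y) = 0" if "x \<in> V" "y \<in> V" "z \<in> V" for x y z
    using that unfolding taos_bracket_def by (simp add: lin mult_closed mult_assoc)
  ultimately show ?thesis
    unfolding lie_algebra_on_def using subspace_V mult_closed
    by (auto simp: taos_bracket_def)
qed

lemma lookup_bracket:
  "x \<in> V \<Longrightarrow> y \<in> V \<Longrightarrow> lookup (taos_bracket x y) (s, v) =
    (\<Sum>t\<in>P. lookup x (s, t) * lookup y (t, v)) - (\<Sum>t\<in>P. lookup y (s, t) * lookup x (t, v))"
  by (simp add: taos_bracket_def lookup_minus lookup_mult)

end

section \<open>Structure constants in the weighted orthonormal basis\<close>

locale weighted_taos = finite_taos +
  fixes q :: "'a \<Rightarrow> real"
  assumes q_pos: "q t > 0"
begin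

definition ip :: "('a \<times> 'a \<Rightarrow>\<^sub>0 real) \<Rightarrow> ('a \<times> 'a \<Rightarrow>\<^sub>0 real) \<Rightarrow> real" where
  "ip x y = (\<Sum>b\<in>B. q (snd b) * lookup x b * lookup y b)"

lemma inner_product: "inner_product_on V ip"
proof -
  have "ip x x > 0" if x: "x \<in> V" "x \<noteq> 0" for x
  proof -
    obtain b where b: "lookup x b \<noteq> 0" using x(2) by (metis lookup_zero poly_mapping_eqI)
    then have "b \<in> B" using V_zero x(1) by blast
    then show ?thesis unfolding ip_def
      using b q_pos
      by (intro sum_pos2[OF finite_B, of b])
         (simp_all add: mult.assoc zero_less_mult_iff less_imp_le not_less neq_iff[symmetric])
  qed
  then show ?thesis
    unfolding inner_product_on_def bilinear_on_def linear_on_def ip_def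
    by (auto simp: lookup_add sum.distrib sum_distrib_left algebra_simps)
qed

lemma metric_lie: "metric_lie V taos_bracket ip"
proof -
  have "span ((\<lambda>b. Poly_Mapping.single b 1) ` B) = V"
  proof
    show "span ((\<lambda>b. Poly_Mapping.single b 1) ` B) \<subseteq> V"
      by (rule span_minimal[OF _ subspace_V]) (auto simp: V_iff lookup_single when_def)
    show "V \<subseteq> span ((\<lambda>b. Poly_Mapping.single b 1) ` B)"
    proof
      fix x assume "x \<in> V"
      then have "x = (\<Sum>b\<in>B. lookup x b *\<^sub>R Poly_Mapping.single b 1)"
        by (intro free_space_expansion finite_B) (simp add: taos_algebra_def)
      then show "x \<in> span ((\<lambda>b. Poly_Mapping.single b 1) ` B)"
        by (metis (no_types, lifting) image_eqI span_base span_scale span_sum)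
    qed
  qed
  then show ?thesis
    unfolding metric_lie_def metric_lie_algebra_def using lie inner_product finite_B
    by (auto intro!: exI[of _ "(\<lambda>b. Poly_Mapping.single b 1) ` B"])
qed

definition unit :: "'a \<times> 'a \<Rightarrow> ('a \<times> 'a \<Rightarrow>\<^sub>0 real)" where
  "unit b = Poly_Mapping.single b (1 / sqrt (q (snd b)))"

lemma unit_V: "b \<in> B \<Longrightarrow> unit b \<in> V"
  by (auto simp: unit_def V_iff lookup_single when_def)

lemma lookup_unit: "lookup (unit b) c = (if b = c then 1 / sqrt (q (snd b)) else 0)"
  by (simp add: unit_def lookup_single when_def)

lemma ip_unit:
  assumes "b \<in> B" shows "ip x (unit b) = sqrt (q (snd b)) * lookup x b"
proof -
  have "ip x (unit b) = (\<Sum>c\<in>B. if c = b then q (snd b) * lookup x b / sqrt (q (snd b)) else 0)"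
    unfolding ip_def by (intro sum.cong) (auto simp: lookup_unit)
  also have "\<dots> = q (snd b) / sqrt (q (snd b)) * lookup x b"
    using assms finite_B by simp
  also have "\<dots> = sqrt (q (snd b)) * lookup x b"
    using q_pos[of "snd b"] by (simp add: real_div_sqrt)
  finally show ?thesis .
qed

lemma unit_inj: "inj unit"
proof (rule injI)
  fix a b assume "unit a = unit b"
  then have "lookup (unit a) a = lookup (unit b) a" by simp
  then show "a = b" using q_pos[of "snd a"] by (auto simp: lookup_unit split: if_splits)
qed

lemma orthonormal: "orthonormal_basis V ip (unit ` B)"
proof -
  have "ip (unit a) (unit b) = (if unit a = unit b then 1 else 0)" if "a \<in> B" "b \<in> B" for a b
    using that q_pos[of "snd b"] inj_eq[OF unit_inj, of a b]
    by (auto simp: ip_unit lookup_unit)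
  moreover have "span (unit ` B) = V"
  proof
    show "span (unit ` B) \<subseteq> V" by (rule span_minimal[OF _ subspace_V]) (auto simp: unit_V)
    show "V \<subseteq> span (unit ` B)"
    proof
      fix x assume "x \<in> V"
      then have "x = (\<Sum>b\<in>B. lookup x b *\<^sub>R Poly_Mapping.single b 1)"
        by (intro free_space_expansion finite_B) (simp add: taos_algebra_def)
      also have "\<dots> = (\<Sum>b\<in>B. (lookup x b * sqrt (q (snd b))) *\<^sub>R unit b)"
        using q_pos by (intro sum.cong refl poly_mapping_eqI)
          (auto simp: lookup_unit lookup_single when_def less_imp_neq[symmetric])
      also have "\<dots> \<in> span (unit ` B)" by (intro span_sum span_scale span_base) auto
      finally show "x \<in> span (unit ` B)" .
    qed
  qed
  ultimately show ?thesis unfolding orthonormal_basis_def using finite_B by auto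
qed


text \<open>
  Giving \<open>(s, v)\<close> the squared length \<open>q v\<close> turns the structure constant of \<open>(s, t) \<cdot> (t, v) = (s, v)\<close>
  in the orthonormal basis \<open>unit ` B\<close> into \<open>1 / sqrt (q t)\<close>, which depends only on the middle point.
\<close>

definition ric :: "'a \<times> 'a \<Rightarrow> real" where
  "ric b = (case b of (s, v) \<Rightarrow>
     ((\<Sum>t | (s, t) \<in> B \<and> (t, v) \<in> B. 1 / q t)
      - card {u. (v, u) \<in> B} / q v - card {u. (u, s) \<in> B} / q s) / 2)"

lemma lookup_bracket_unit:
  assumes "X \<in> V" "(p, t) \<in> B"
  shows "lookup (taos_bracket X (unit (p, t))) (s, v) =
    ((if t = v then lookup X (s, p) else 0) - (if s = p then lookup X (t, v) else 0)) / sqrt (q t)"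
proof -
  have "p \<in> P" "t \<in> P" using assms(2) B_subset by auto
  have 1: "(\<Sum>u\<in>P. lookup X (s, u) * lookup (unit (p, t)) (u, v))
      = (\<Sum>u\<in>P. if u = p then (if t = v then lookup X (s, p) / sqrt (q t) else 0) else 0)"
    by (intro sum.cong) (auto simp: lookup_unit)
  have 2: "(\<Sum>u\<in>P. lookup (unit (p, t)) (s, u) * lookup X (u, v))
      = (\<Sum>u\<in>P. if u = t then (if s = p then lookup X (t, v) / sqrt (q t) else 0) else 0)"
    by (intro sum.cong) (auto simp: lookup_unit)
  show ?thesis
    unfolding lookup_bracket[OF assms(1) unit_V[OF assms(2)]] 1 2
    using finite_P \<open>p \<in> P\<close> \<open>t \<in> P\<close> by (simp add: diff_divide_distrib)
qed

lemma ip_bracket_unit: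
  assumes "X \<in> V" "(p, t) \<in> B" "(s, v) \<in> B"
  shows "ip (taos_bracket X (unit (p, t))) (unit (s, v)) = sqrt (q v / q t) *
    ((if t = v then lookup X (s, p) else 0) - (if s = p then lookup X (t, v) else 0))"
  by (simp add: ip_unit assms(3) lookup_bracket_unit[OF assms(1,2)] real_sqrt_divide)

lemma ip_bracket_units:
  assumes "X \<in> V" "(p, t) \<in> B" "(s, v) \<in> B"
  shows "ip (taos_bracket (unit (p, t)) (unit (s, v))) X =
    ((if t = s then q v * lookup X (p, v) else 0) - (if v = p then q t * lookup X (s, t) else 0))
    / (sqrt (q t) * sqrt (q v))"
proof -
  define c where "c = sqrt (q t) * sqrt (q v)"
  have "lookup (taos_bracket (unit (p, t)) (unit (s, v))) b =
      ((if b = (p, v) \<and> t = s then 1 else 0) - (if b = (s, t) \<and> v = p then 1 else 0)) / c" for b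
    using lookup_bracket_unit[OF unit_V[OF assms(2)] assms(3), of "fst b" "snd b"] B_irrefl assms
    by (cases b) (auto simp: lookup_unit c_def)
  then have "ip (taos_bracket (unit (p, t)) (unit (s, v))) X = (\<Sum>b\<in>B. q (snd b) *
      (((if b = (p, v) \<and> t = s then 1 else 0) - (if b = (s, t) \<and> v = p then 1 else 0)) / c)
      * lookup X b)"
    unfolding ip_def by simp
  also have "\<dots> = (\<Sum>b\<in>B. (if b = (p, v) then if t = s then q v * lookup X (p, v) / c else 0 else 0)
      - (if b = (s, t) then if v = p then q t * lookup X (s, t) / c else 0 else 0))"
  proof (intro sum.cong refl)
    fix b
    have "p \<noteq> t" "s \<noteq> v" using assms B_irrefl by auto
    then show "q (snd b) * (((if b = (p, v) \<and> t = s then 1 else 0)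
        - (if b = (s, t) \<and> v = p then 1 else 0)) / c) * lookup X b
      = (if b = (p, v) then if t = s then q v * lookup X (p, v) / c else 0 else 0)
        - (if b = (s, t) then if v = p then q t * lookup X (s, t) / c else 0 else 0)"
      by (cases "t = s"; cases "v = p"; cases "b = (p, v)"; cases "b = (s, t)") auto
  qed
  also have "\<dots> = (if t = s then q v * lookup X (p, v) / c else 0)
      - (if v = p then q t * lookup X (s, t) / c else 0)"
  proof -
    have "t = s \<Longrightarrow> (p, v) \<in> B" "v = p \<Longrightarrow> (s, t) \<in> B" using assms B_trans by blast+
    then show ?thesis
      unfolding sum_subtractf using finite_B by auto
  qed
  also have "\<dots> = ((if t = s then q v * lookup X (p, v) else 0)
      - (if v = p then q t * lookup X (s, t) else 0)) / c"
    by (simp add: diff_divide_distrib)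
  finally show ?thesis unfolding c_def .
qed

lemma sum_over_unit: "(\<Sum>e\<in>unit ` B. f e) = (\<Sum>b\<in>B. f (unit b))"
  by (rule sum.reindex_cong[OF inj_on_subset[OF unit_inj]]) auto

lemma sum_over_pairs:
  "(\<Sum>a\<in>B. \<Sum>b\<in>B. f a b) = (\<Sum>p\<in>P. \<Sum>t\<in>P. \<Sum>s\<in>P. \<Sum>v\<in>P.
     if (p, t) \<in> B \<and> (s, v) \<in> B then f (p, t) (s, v) else 0)"
  unfolding sum_B by (intro sum.cong refl) auto

lemma card_as_sum:
  assumes "\<And>u. Q u \<Longrightarrow> u \<in> P"
  shows "(\<Sum>u\<in>P. if Q u then c else 0) = real (card {u. Q u}) * c"
proof -
  have "P \<inter> {u. Q u} = {u. Q u}" using assms by auto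
  then show ?thesis using finite_P by (simp add: sum.If_cases)
qed

text \<open>An entry of \<open>X\<close> at \<open>(s, p)\<close> acts from the left on each
  \<open>(p, t)\<close>, with weight 1; one at \<open>(t, v)\<close> acts from the right on each
  \<open>(p, t)\<close>, with weight \<open>q v / q t\<close>. Counting the free index gives the two
  cardinalities. Mixed terms would contain diagonal entries of \<open>X\<close> or \<open>Y\<close>,
  which are zero.\<close>

lemma ad_term:
  assumes XY: "X \<in> V" "Y \<in> V"
  shows "(\<Sum>a\<in>B. \<Sum>b\<in>B. ip (taos_bracket X (unit a)) (unit b) * ip (taos_bracket Y (unit a)) (unit b))
    = (\<Sum>b\<in>B. q (snd b) * (card {u. (snd b, u) \<in> B} / q (snd b) + card {u. (u, fst b) \<in> B} / q (fst b))
        * (lookup X b * lookup Y b))"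
proof -
  let ?XY = "\<lambda>s t. lookup X (s, t) * lookup Y (s, t)"
  have XY0: "?XY s t = 0" if "(s, t) \<notin> B" for s t using V_zero[OF XY(1) that] by simp
  have summand: "(if (p, t) \<in> B \<and> (s, v) \<in> B
        then ip (taos_bracket X (unit (p, t))) (unit (s, v)) * ip (taos_bracket Y (unit (p, t))) (unit (s, v))
        else 0)
      = (if v = t then if (p, t) \<in> B then ?XY s p else 0 else 0)
        + (if p = s then if (s, t) \<in> B then q v / q t * ?XY t v else 0 else 0)" for p t s v
  proof (cases "(p, t) \<in> B \<and> (s, v) \<in> B")
    case True
    have sq: "sqrt (q v / q t) * a * (sqrt (q v / q t) * b) = q v / q t * (a * b)" for a b
      using q_pos[of v] q_pos[of t] real_sqrt_mult_self[of "q v / q t"]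
      by (metis abs_of_pos divide_pos_pos mult.assoc mult.left_commute)
    have "ip (taos_bracket X (unit (p, t))) (unit (s, v)) * ip (taos_bracket Y (unit (p, t))) (unit (s, v))
        = q v / q t *
          (((if t = v then lookup X (s, p) else 0) - (if s = p then lookup X (t, v) else 0))
           * ((if t = v then lookup Y (s, p) else 0) - (if s = p then lookup Y (t, v) else 0)))"
      unfolding ip_bracket_unit[OF XY(1) conjunct1[OF True] conjunct2[OF True]]
        ip_bracket_unit[OF XY(2) conjunct1[OF True] conjunct2[OF True]] by (rule sq)
    then show ?thesis
      using True q_pos[of t] V_zero[OF XY(1) B_irrefl] V_zero[OF XY(2) B_irrefl] by auto
  next
    case False
    then show ?thesis using XY0[of s p] XY0[of t v] B_trans by auto
  qed
  have "(\<Sum>a\<in>B. \<Sum>b\<in>B. ip (taos_bracket X (unit a)) (unit b) * ip (taos_bracket Y (unit a)) (unit b))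
      = (\<Sum>p\<in>P. \<Sum>t\<in>P. \<Sum>s\<in>P. if (p, t) \<in> B then ?XY s p else 0)
        + (\<Sum>p\<in>P. \<Sum>t\<in>P. \<Sum>v\<in>P. if (p, t) \<in> B then q v / q t * ?XY t v else 0)"
  proof -
    have "(\<Sum>s\<in>P. \<Sum>v\<in>P. if p = s then if (s, t) \<in> B then q v / q t * ?XY t v else 0 else 0)
        = (\<Sum>v\<in>P. if (p, t) \<in> B then q v / q t * ?XY t v else 0)" if "p \<in> P" for p t
      using finite_P that by (subst sum.swap) simp
    then show ?thesis
      unfolding sum_over_pairs summand using finite_P by (simp add: sum.distrib)
  qed
  also have "(\<Sum>p\<in>P. \<Sum>t\<in>P. \<Sum>s\<in>P. if (p, t) \<in> B then ?XY s p else 0)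
      = (\<Sum>p\<in>P. \<Sum>s\<in>P. \<Sum>t\<in>P. if (p, t) \<in> B then ?XY s p else 0)"
    by (intro sum.cong refl sum.swap)
  also have "\<dots> = (\<Sum>p\<in>P. \<Sum>s\<in>P. card {t. (p, t) \<in> B} * ?XY s p)"
    using B_subset by (intro sum.cong refl card_as_sum) blast
  also have "\<dots> = (\<Sum>s\<in>P. \<Sum>p\<in>P. card {t. (p, t) \<in> B} * ?XY s p)"
    by (rule sum.swap)
  also have "\<dots> = (\<Sum>b\<in>B. card {t. (snd b, t) \<in> B} * (lookup X b * lookup Y b))"
    unfolding sum_B using XY0 by (intro sum.cong refl) auto
  also have "(\<Sum>p\<in>P. \<Sum>t\<in>P. \<Sum>v\<in>P. if (p, t) \<in> B then q v / q t * ?XY t v else 0)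
      = (\<Sum>t\<in>P. \<Sum>p\<in>P. \<Sum>v\<in>P. if (p, t) \<in> B then q v / q t * ?XY t v else 0)"
    by (rule sum.swap)
  also have "\<dots> = (\<Sum>t\<in>P. \<Sum>v\<in>P. \<Sum>p\<in>P. if (p, t) \<in> B then q v / q t * ?XY t v else 0)"
    by (intro sum.cong refl sum.swap)
  also have "\<dots> = (\<Sum>t\<in>P. \<Sum>v\<in>P. card {p. (p, t) \<in> B} * (q v / q t * ?XY t v))"
    using B_subset by (intro sum.cong refl card_as_sum) blast
  also have "\<dots> = (\<Sum>b\<in>B. card {p. (p, fst b) \<in> B} * (q (snd b) / q (fst b) * (lookup X b * lookup Y b)))"
    unfolding sum_B using XY0 by (intro sum.cong refl) auto
  finally show ?thesis
    unfolding sum.distrib[symmetric]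
  proof (rule trans, intro sum.cong refl)
    fix b
    show "card {t. (snd b, t) \<in> B} * (lookup X b * lookup Y b)
        + card {p. (p, fst b) \<in> B} * (q (snd b) / q (fst b) * (lookup X b * lookup Y b))
      = q (snd b) * (card {u. (snd b, u) \<in> B} / q (snd b) + card {u. (u, fst b) \<in> B} / q (fst b))
        * (lookup X b * lookup Y b)"
      using q_pos[of "fst b"] q_pos[of "snd b"] by (simp add: field_simps)
  qed
qed

text \<open>The product \<open>(s, t) (t, v) = (s, v)\<close> appears in the brackets of both
  orders, whence the factor 2. The two products \<open>a b\<close> and \<open>b a\<close> are never
  both nonzero, since that would need a pair and its reverse in \<open>B\<close>.\<close>

lemma image_term:
  assumes XY: "X \<in> V" "Y \<in> V"
  shows "(\<Sum>a\<in>B. \<Sum>b\<in>B. ip (taos_bracket (unit a) (unit b)) X * ip (taos_bracket (unit a) (unit b)) Y)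
    = 2 * (\<Sum>b\<in>B. q (snd b) * (\<Sum>t | (fst b, t) \<in> B \<and> (t, snd b) \<in> B. 1 / q t)
        * (lookup X b * lookup Y b))"
proof -
  let ?XY = "\<lambda>s t. lookup X (s, t) * lookup Y (s, t)"
  have XY0: "?XY s t = 0" if "(s, t) \<notin> B" for s t using V_zero[OF XY(1) that] by simp
  define h where "h a b = (if snd a = fst b then q (snd b) / q (snd a) * ?XY (fst a) (snd b) else 0)"
    for a b :: "'a \<times> 'a"
  have summand: "ip (taos_bracket (unit a) (unit b)) X * ip (taos_bracket (unit a) (unit b)) Y
      = h a b + h b a" if "a \<in> B" "b \<in> B" for a b
  proof -
    obtain p t s v where ab: "a = (p, t)" "b = (s, v)" by fastforce
    have ne: "\<not> (t = s \<and> v = p)" using that B_asym ab by auto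
    have "sqrt (q t) * sqrt (q v) * (sqrt (q t) * sqrt (q v)) = q t * q v"
      using q_pos[of t] q_pos[of v]
        real_sqrt_mult_self[of "q t"] real_sqrt_mult_self[of "q v"]
      by (simp add: mult_ac)
    then have "ip (taos_bracket (unit a) (unit b)) X * ip (taos_bracket (unit a) (unit b)) Y
        = ((if t = s then q v * lookup X (p, v) else 0) - (if v = p then q t * lookup X (s, t) else 0))
         * ((if t = s then q v * lookup Y (p, v) else 0) - (if v = p then q t * lookup Y (s, t) else 0))
         / (q t * q v)"
      using that XY by (simp add: ab ip_bracket_units)
    then show ?thesis
      using ne q_pos[of t] q_pos[of v] by (auto simp: h_def ab)
  qed
  have "(\<Sum>a\<in>B. \<Sum>b\<in>B. ip (taos_bracket (unit a) (unit b)) X * ip (taos_bracket (unit a) (unit b)) Y)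
      = (\<Sum>a\<in>B. \<Sum>b\<in>B. h a b) + (\<Sum>a\<in>B. \<Sum>b\<in>B. h b a)"
    using summand by (simp add: sum.distrib)
  also have "(\<Sum>a\<in>B. \<Sum>b\<in>B. h b a) = (\<Sum>a\<in>B. \<Sum>b\<in>B. h a b)" by (rule sum.swap)
  also have "(\<Sum>a\<in>B. \<Sum>b\<in>B. h a b) = (\<Sum>p\<in>P. \<Sum>t\<in>P. \<Sum>s\<in>P. \<Sum>v\<in>P.
      if s = t then if (p, t) \<in> B \<and> (t, v) \<in> B then q v / q t * ?XY p v else 0 else 0)"
    unfolding sum_over_pairs by (intro sum.cong refl) (auto simp: h_def)
  also have "\<dots> = (\<Sum>p\<in>P. \<Sum>t\<in>P. \<Sum>v\<in>P. \<Sum>s\<in>P.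
      if s = t then if (p, t) \<in> B \<and> (t, v) \<in> B then q v / q t * ?XY p v else 0 else 0)"
    by (intro sum.cong refl sum.swap)
  also have "\<dots> = (\<Sum>p\<in>P. \<Sum>t\<in>P. \<Sum>v\<in>P.
      if (p, t) \<in> B \<and> (t, v) \<in> B then q v / q t * ?XY p v else 0)"
    using finite_P by simp
  also have "\<dots> = (\<Sum>p\<in>P. \<Sum>v\<in>P. \<Sum>t\<in>P.
      if (p, t) \<in> B \<and> (t, v) \<in> B then q v / q t * ?XY p v else 0)"
    by (intro sum.cong refl sum.swap)
  also have "\<dots> = (\<Sum>p\<in>P. \<Sum>v\<in>P.
      q v * (\<Sum>t | (p, t) \<in> B \<and> (t, v) \<in> B. 1 / q t) * ?XY p v)"
  proof (intro sum.cong refl)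
    fix p v
    have "(\<Sum>t\<in>P. if (p, t) \<in> B \<and> (t, v) \<in> B then q v / q t * ?XY p v else 0)
        = (\<Sum>t | (p, t) \<in> B \<and> (t, v) \<in> B. q v / q t * ?XY p v)"
      using finite_P B_subset by (intro sum.mono_neutral_cong_right) auto
    then show "(\<Sum>t\<in>P. if (p, t) \<in> B \<and> (t, v) \<in> B then q v / q t * ?XY p v else 0)
        = q v * (\<Sum>t | (p, t) \<in> B \<and> (t, v) \<in> B. 1 / q t) * ?XY p v"
      by (simp add: sum_distrib_left sum_distrib_right)
  qed
  also have "\<dots> = (\<Sum>b\<in>B. q (snd b) * (\<Sum>t | (fst b, t) \<in> B \<and> (t, snd b) \<in> B. 1 / q t)
        * (lookup X b * lookup Y b))"
    unfolding sum_B using XY0 by (intro sum.cong refl) auto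
  finally show ?thesis by simp
qed

text \<open>Vanishing of the Killing form, term by term: if an entry of \<open>X\<close> at
  \<open>(x, y)\<close> leads from \<open>a\<close> to \<open>b\<close>, then the way back needs an
  entry of \<open>Y\<close> at \<open>(y, x)\<close>, which antisymmetry forbids.\<close>

lemma killing_term:
  assumes XY: "X \<in> V" "Y \<in> V" and ab: "a \<in> B" "b \<in> B"
  shows "ip (taos_bracket X (unit a)) (unit b) * ip (taos_bracket Y (unit b)) (unit a) = 0"
proof -
  obtain p t s v where pt: "a = (p, t)" "b = (s, v)" by fastforce
  have asym: "lookup X (x, y) = 0 \<or> lookup Y (y, x) = 0" for x y
    using V_zero[OF XY(1), of "(x, y)"] V_zero[OF XY(2), of "(y, x)"] B_asym by blast
  have irrefl: "lookup X (x, x) = 0" for x using V_zero[OF XY(1) B_irrefl] .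
  show ?thesis
    using ab asym[of s p] asym[of t v] irrefl
    by (auto simp: pt ip_bracket_unit XY)
qed

lemma lookup_ricci:
  assumes X: "X \<in> V"
  shows "lookup (ricci V taos_bracket ip X) b = ric b * lookup X b"
proof (cases "b \<in> B")
  case True
  interpret metric_lie V taos_bracket ip by (rule metric_lie)
  have ric: "ip (ricci V taos_bracket ip X) Y = (\<Sum>b\<in>B. q (snd b) * ric b * (lookup X b * lookup Y b))"
    if Y: "Y \<in> V" for Y
  proof -
    \<comment> \<open>The coefficient of \<open>unit b\<close> in its bracket with \<open>Z\<close>
      is a difference of two diagonal entries of \<open>Z\<close>, and these vanish.\<close>
    have "ip (taos_bracket Z (unit b)) (unit b) = 0" if "Z \<in> V" "b \<in> B" for Z b
      using that V_zero[OF that(1) B_irrefl] by (cases b) (simp add: ip_bracket_unit)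
    then have unimodular: "(\<Sum>e\<in>unit ` B. ip (taos_bracket Z e) e) = 0" if "Z \<in> V" for Z
      unfolding sum_over_unit using that by (intro sum.neutral) blast
    have killing: "(\<Sum>a\<in>B. \<Sum>b\<in>B. ip (taos_bracket X (unit a)) (unit b)
        * ip (taos_bracket Y (unit b)) (unit a)) = 0"
      using killing_term[OF X Y] by (intro sum.neutral ballI) blast
    have half: "2 * (\<Sum>b\<in>B. f b) / 4 - (\<Sum>b\<in>B. g b) / 2 - 0 / 2 = (\<Sum>b\<in>B. (f b - g b) / 2)"
      for f g :: "'a \<times> 'a \<Rightarrow> real"
      by (simp add: sum_subtractf sum_divide_distrib[symmetric] diff_divide_distrib)
    have "ip (ricci V taos_bracket ip X) Y = (\<Sum>b\<in>B. (q (snd b) *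
          (\<Sum>t | (fst b, t) \<in> B \<and> (t, snd b) \<in> B. 1 / q t) * (lookup X b * lookup Y b)
        - q (snd b) * (card {u. (snd b, u) \<in> B} / q (snd b) + card {u. (u, fst b) \<in> B} / q (fst b))
        * (lookup X b * lookup Y b)) / 2)"
      using ip_ricci[OF orthonormal X Y unimodular]
      unfolding sum_over_unit ad_term[OF X Y] image_term[OF X Y] killing half .
    then show ?thesis
      by (elim trans, intro sum.cong refl) (auto simp: ric_def algebra_simps diff_divide_distrib add_divide_distrib)
  qed
  \<comment> \<open>Taking \<open>unit b\<close> as the test vector isolates coordinate
    \<open>b\<close>, up to a positive factor common to both sides.\<close>
  have "sqrt (q (snd b)) * lookup (ricci V taos_bracket ip X) b
      = ip (ricci V taos_bracket ip X) (unit b)"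
    using True by (simp add: ip_unit)
  also have "\<dots> = (\<Sum>c\<in>B. q (snd c) * ric c * (lookup X c * lookup (unit b) c))"
    using True by (intro ric unit_V)
  also have "\<dots> = (\<Sum>c\<in>B. if c = b then q (snd b) / sqrt (q (snd b)) * ric b * lookup X b else 0)"
    by (intro sum.cong refl) (auto simp: lookup_unit)
  also have "\<dots> = sqrt (q (snd b)) * (ric b * lookup X b)"
    using True finite_B q_pos[of "snd b"] by (simp add: real_div_sqrt)
  finally show ?thesis using q_pos[of "snd b"] by simp
next
  case False
  then show ?thesis
    using metric_lie.ricci_closed[OF metric_lie orthonormal X] V_zero X by auto
qed

text \<open>The candidate for \<open>D\<close> is \<open>Ric + id\<close>, with eigenvalues
  \<open>1 + ric b\<close>. Their additivity contains one constant on the left and two on the right,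
  which leaves the summand 1 of the hypothesis.\<close>

lemma soliton:
  assumes additive: "\<And>s t v. (s, t) \<in> B \<Longrightarrow> (t, v) \<in> B \<Longrightarrow> ric (s, v) = ric (s, t) + ric (t, v) + 1"
  shows "algebraic_ricci_soliton V taos_bracket ip (- 1)"
proof -
  let ?D = "\<lambda>X. X + ricci V taos_bracket ip X"
  have closed: "ricci V taos_bracket ip X \<in> V" if "X \<in> V" for X
    using metric_lie.ricci_closed[OF metric_lie orthonormal that] .
  have D: "lookup (?D X) b = (1 + ric b) * lookup X b" if "X \<in> V" for X b
    using lookup_ricci[OF that] by (simp add: lookup_add algebra_simps)
  have "?D (taos_bracket x y) = taos_bracket (?D x) y + taos_bracket x (?D y)"
    if x: "x \<in> V" and y: "y \<in> V" for x y
  proof (rule poly_mapping_eqI)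
    fix b obtain s v :: 'a where b: "b = (s, v)" by fastforce
    have br: "taos_bracket x y \<in> V"
      using lie x y by (auto simp: lie_algebra_on_def)
    \<comment> \<open>Additivity is available only for composable pairs in \<open>B\<close>; for all
      other \<open>t\<close> one of the two coefficients is zero, so the identity can be summed over
      the whole of \<open>P\<close>.\<close>
    have add: "(1 + ric (s, v)) * (lookup x (s, t) * lookup y (t, v))
        = (1 + ric (s, t)) * lookup x (s, t) * lookup y (t, v)
          + lookup x (s, t) * ((1 + ric (t, v)) * lookup y (t, v))"
      if "x \<in> V" "y \<in> V" for x y t
      using additive[of s t v] V_zero[OF that(1), of "(s, t)"] V_zero[OF that(2), of "(t, v)"]
      by (cases "(s, t) \<in> B \<and> (t, v) \<in> B") (auto simp: algebra_simps)
    show "lookup (?D (taos_bracket x y)) b = lookup (taos_bracket (?D x) y + taos_bracket x (?D y)) b"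
      unfolding D[OF br]
      using x y closed
      by (simp add: b lookup_add[of "taos_bracket _ _"] lookup_bracket D right_diff_distrib
        sum_distrib_left add sum.distrib)
  qed
  moreover have "?D x \<in> V" if "x \<in> V" for x using that closed by simp
  moreover have "linear_on V ?D"
    unfolding linear_on_def
    by (auto intro!: poly_mapping_eqI simp: D lookup_add[of "_ + ricci _ _ _ _"] algebra_simps)
       (simp_all add: lookup_add lookup_ricci algebra_simps)
  ultimately have "?D \<in> derivations V taos_bracket" by (simp add: derivations_def)
  then show ?thesis
    unfolding algebraic_ricci_soliton_def
    using metric_lie by (auto simp: metric_lie_def intro!: bexI[of _ ?D])
qed

end

section \<open>Algebraically connected components\<close>

lemma free_space_mono: "A \<subseteq> B \<Longrightarrow> free_space A \<subseteq> free_space B"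
  by (auto simp: free_space_def)

lemma free_space_direct_sum:
  assumes I: "finite I" and disj: "disjoint_family_on A I" and x: "x \<in> free_space (\<Union>i\<in>I. A i)"
  shows "\<exists>!f. f \<in> (\<Pi>\<^sub>E i\<in>I. free_space (A i)) \<and> x = (\<Sum>i\<in>I. f i)"
proof (rule ex1I)
  define f where "f = (\<lambda>i\<in>I. \<Sum>b\<in>Poly_Mapping.keys x \<inter> A i. Poly_Mapping.single b (lookup x b))"
  have lf: "lookup (f i) b = (if b \<in> A i then lookup x b else 0)" if "i \<in> I" for i b
  proof -
    have "lookup (f i) b = (\<Sum>c\<in>Poly_Mapping.keys x \<inter> A i. if c = b then lookup x b else 0)"
      using that unfolding f_def by (auto simp: lookup_sum lookup_single when_def intro!: sum.cong)
    then show ?thesis by (auto simp: in_keys_iff)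
  qed
  have single_term: "(\<Sum>i\<in>I. lookup (g i) b) = lookup (g j) b"
    if "j \<in> I" "b \<in> A j" "g \<in> (\<Pi>\<^sub>E i\<in>I. free_space (A i))" for g :: "'a \<Rightarrow> 'b \<Rightarrow>\<^sub>0 real" and b j
  proof -
    have "lookup (g i) b = (if i = j then lookup (g j) b else 0)" if "i \<in> I" for i
    proof -
      have "b \<notin> A i" if "i \<noteq> j"
        using disj \<open>i \<in> I\<close> \<open>j \<in> I\<close> \<open>b \<in> A j\<close> that by (auto simp: disjoint_family_on_def)
      then show ?thesis using \<open>i \<in> I\<close> \<open>g \<in> _\<close> by (auto simp: PiE_iff free_space_iff)
    qed
    then have "(\<Sum>i\<in>I. lookup (g i) b) = (\<Sum>i\<in>I. if i = j then lookup (g j) b else 0)"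
      by (intro sum.cong) auto
    then show ?thesis using I that(1) by simp
  qed
  have f: "f \<in> (\<Pi>\<^sub>E i\<in>I. free_space (A i))"
    using lf by (auto simp: PiE_iff free_space_iff f_def)
  moreover have "x = (\<Sum>i\<in>I. f i)"
  proof (rule poly_mapping_eqI)
    fix b
    show "lookup x b = lookup (\<Sum>i\<in>I. f i) b"
    proof (cases "\<exists>j\<in>I. b \<in> A j")
      case True
      then show ?thesis using single_term[OF _ _ f] lf by (auto simp: lookup_sum)
    next
      case False
      then show ?thesis using x lf by (auto simp: lookup_sum free_space_iff)
    qed
  qed
  ultimately show "f \<in> (\<Pi>\<^sub>E i\<in>I. free_space (A i)) \<and> x = (\<Sum>i\<in>I. f i)" ..
  fix g assume g: "g \<in> (\<Pi>\<^sub>E i\<in>I. free_space (A i)) \<and> x = (\<Sum>i\<in>I. g i)"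
  show "g = f"
  proof (rule PiE_ext[of _ I "\<lambda>i. free_space (A i)"])
    fix i assume i: "i \<in> I"
    show "g i = f i"
    proof (rule poly_mapping_eqI)
      fix b
      show "lookup (g i) b = lookup (f i) b"
      proof (cases "b \<in> A i")
        case True
        then show ?thesis using single_term[OF i True, of g] g lf[OF i] by (simp add: lookup_sum)
      next
        case False
        then show ?thesis using g i lf[OF i] by (auto simp: PiE_iff free_space_iff)
      qed
    qed
  qed (use g f in auto)
qed

text \<open>A nonempty list of arrows determines its vertices, so the walk condition becomes a local
  one on consecutive arrows, stable under taking pieces of a path.\<close>

lemma quiver_paths_iff:
  assumes "wf_digraph Q"
  shows "p \<in> quiver_paths Q \<longleftrightarrow>
    p \<noteq> [] \<and> set p \<subseteq> arcs Q \<and> successively (\<lambda>a b. head Q a = tail Q b) p"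
proof -
  have "(\<exists>v. pre_digraph.cas Q u p v) \<longleftrightarrow>
      successively (\<lambda>a b. head Q a = tail Q b) p \<and> tail Q (hd p) = u" if "p \<noteq> []" for u
    using that
  proof (induction p arbitrary: u rule: induct_list012)
    case (3 a b p)
    then show ?case by (auto simp: pre_digraph.cas.simps)
  qed (auto simp: pre_digraph.cas.simps)
  moreover have "tail Q (hd p) \<in> verts Q" if "p \<noteq> []" "set p \<subseteq> arcs Q"
    using that assms wf_digraph.tail_in_verts hd_in_set by fastforce
  ultimately show ?thesis
    unfolding quiver_paths_def pre_digraph.awalk_def by auto
qed

lemma path_algebra_lookup: "x \<in> path_algebra Q \<Longrightarrow> p \<notin> quiver_paths Q \<Longrightarrow> lookup x p = 0"
  unfolding path_algebra_def free_space_iff by blast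

lemma path_mult_lookup:
  assumes "finite B" "Poly_Mapping.keys x \<subseteq> B" "Poly_Mapping.keys y \<subseteq> B"
  shows "lookup (path_algebra_mult Q x y) c = (\<Sum>p\<in>B. \<Sum>q\<in>B.
    if p @ q = c \<and> c \<in> quiver_paths Q then lookup x p * lookup y q else 0)"
  unfolding path_algebra_mult_def lookup_basis_mult[OF assms] path_concat_def
  by (intro sum.cong refl) auto

lemma path_mult_in_path_algebra: "path_algebra_mult Q x y \<in> path_algebra Q"
  unfolding path_algebra_def free_space_iff
  using path_mult_lookup[of "Poly_Mapping.keys x \<union> Poly_Mapping.keys y" x y Q] by auto

text \<open>A path of length two has only one factorization into nonempty paths. This turns
  annihilation of ideals into a statement about arrow coefficients.\<close>

lemma path_mult_two_arrows:
  assumes x: "x \<in> path_algebra Q" and y: "y \<in> path_algebra Q" and ab: "[a, b] \<in> quiver_paths Q"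
  shows "lookup (path_algebra_mult Q x y) [a, b] = lookup x [a] * lookup y [b]"
proof -
  define B where "B = Poly_Mapping.keys x \<union> Poly_Mapping.keys y \<union> {[a], [b]}"
  have B: "finite B" "Poly_Mapping.keys x \<subseteq> B" "Poly_Mapping.keys y \<subseteq> B" by (auto simp: B_def)
  have nil: "lookup x [] = 0" "lookup y [] = 0"
    using path_algebra_lookup[OF x] path_algebra_lookup[OF y] by (auto simp: quiver_paths_def)
  have "lookup (path_algebra_mult Q x y) [a, b] =
      (\<Sum>p\<in>B. if p = [a] then \<Sum>q\<in>B. if q = [b] then lookup x [a] * lookup y [b] else 0 else 0)"
    unfolding path_mult_lookup[OF B] using nil ab
    by (auto simp: append_eq_Cons_conv intro!: sum.cong sum.neutral)
  then show ?thesis using B(1) by (simp add: B_def)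
qed

text \<open>Products are supported on paths of length at least two.\<close>

lemma path_mult_one_arrow:
  assumes x: "x \<in> path_algebra Q" and y: "y \<in> path_algebra Q"
  shows "lookup (path_algebra_mult Q x y) [a] = 0"
proof -
  have nil: "lookup x [] = 0" "lookup y [] = 0"
    using path_algebra_lookup[OF x] path_algebra_lookup[OF y] by (auto simp: quiver_paths_def)
  then show ?thesis
    by (subst path_mult_lookup[of "Poly_Mapping.keys x \<union> Poly_Mapping.keys y"])
       (auto simp: append_eq_Cons_conv intro!: sum.neutral)
qed

lemma path_mult_zero: "path_algebra_mult Q 0 y = 0" "path_algebra_mult Q x 0 = 0"
  by (simp_all add: path_algebra_mult_def basis_mult_def)

lemma path_mult_single:
  assumes "p @ q \<in> quiver_paths Q"
  shows "path_algebra_mult Q (Poly_Mapping.single p 1) (Poly_Mapping.single q 1)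
    = Poly_Mapping.single (p @ q) 1"
  using assms by (simp add: path_algebra_mult_def basis_mult_def path_concat_def)

lemma subspace_path_algebra: "subspace (path_algebra Q)"
  by (simp add: path_algebra_def subspace_free_space)

definition arc_adjacency :: "('a, 'b) pre_digraph \<Rightarrow> 'b rel" where
  "arc_adjacency Q = {(a, b). a \<in> arcs Q \<and> b \<in> arcs Q \<and> (head Q a = tail Q b \<or> head Q b = tail Q a)}"

lemma sym_arc_adjacency: "sym (arc_adjacency Q)"
  by (auto simp: arc_adjacency_def sym_def)

text \<open>
  In a splitting of the path algebra into two ideals annihilating each other, an arrow occurring in
  the first ideal excludes the arrows composable with it from the second one. Hence all arrows of a
  class belong to the same ideal, and the elements of the other one have no arrow part.
\<close>

theorem algebraically_connectedI:
  assumes Q: "finite_acyclic_quiver Q"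
    and conn: "\<And>a b. a \<in> arcs Q \<Longrightarrow> b \<in> arcs Q \<Longrightarrow> (a, b) \<in> (arc_adjacency Q)\<^sup>*"
  shows "algebraically_connected Q"
proof -
  have wf: "wf_digraph Q" using Q by (simp add: finite_acyclic_quiver_def fin_digraph_def)
  let ?N = "path_algebra Q" and ?m = "path_algebra_mult Q"
  have False if n: "2 \<le> n"
    and F: "\<And>i. i < n \<Longrightarrow> finite_acyclic_quiver (F i) \<and> path_algebra (F i) \<noteq> {0}"
    and iso: "algebras_isomorphic ?N ?m (direct_sum_space n (\<lambda>i. path_algebra (F i)))
      (direct_sum_mult n (\<lambda>i. path_algebra_mult (F i)))"
    for n and F :: "nat \<Rightarrow> (nat, nat) pre_digraph"
  proof -
    let ?S = "direct_sum_space n (\<lambda>i. path_algebra (F i))"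
    obtain \<phi> where lin: "linear_on ?N \<phi>" and bij: "bij_betw \<phi> ?N ?S"
      and mult: "\<And>x y. x \<in> ?N \<Longrightarrow> y \<in> ?N \<Longrightarrow>
        \<phi> (?m x y) = direct_sum_mult n (\<lambda>i. path_algebra_mult (F i)) (\<phi> x) (\<phi> y)"
      using iso unfolding algebras_isomorphic_def by blast
    define \<pi> where "\<pi> i x = lookup (\<phi> x) i" for i x
    have N: "0 \<in> ?N" "\<And>x y. x \<in> ?N \<Longrightarrow> y \<in> ?N \<Longrightarrow> x + y \<in> ?N"
      "\<And>c x. x \<in> ?N \<Longrightarrow> c *\<^sub>R x \<in> ?N" "\<And>x y. x \<in> ?N \<Longrightarrow> y \<in> ?N \<Longrightarrow> x - y \<in> ?N"
      using subspace_path_algebra[of Q]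
      by (simp_all add: subspace_0 subspace_add subspace_scale subspace_diff)
    have \<phi>_add: "\<phi> (x + y) = \<phi> x + \<phi> y" if "x \<in> ?N" "y \<in> ?N" for x y
      using lin that by (simp add: linear_on_def)
    have \<phi>_scale: "\<phi> (c *\<^sub>R x) = c *\<^sub>R \<phi> x" if "x \<in> ?N" for c x
      using lin that by (simp add: linear_on_def)
    have \<phi>_diff: "\<phi> (x - y) = \<phi> x - \<phi> y" if "x \<in> ?N" "y \<in> ?N" for x y
      using \<phi>_add[OF N(4)[OF that] that(2)] by simp
    have \<phi>0: "\<phi> 0 = 0" using \<phi>_scale[OF N(1), of 0] by simp
    have \<phi>_inj: "x = y" if "x \<in> ?N" "y \<in> ?N" "\<phi> x = \<phi> y" for x y
      using bij that by (auto simp: bij_betw_def inj_on_def)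
    have \<pi>_in: "\<pi> i x \<in> path_algebra (F i)" if "x \<in> ?N" "i < n" for i x
      using bij that by (auto simp: bij_betw_def direct_sum_space_def \<pi>_def)
    have \<pi>_out: "\<pi> i x = 0" if "x \<in> ?N" "n \<le> i" for i x
      using bij that by (auto simp: bij_betw_def direct_sum_space_def \<pi>_def)
    have \<pi>_mult: "\<pi> i (?m x y) = path_algebra_mult (F i) (\<pi> i x) (\<pi> i y)"
      if "x \<in> ?N" "y \<in> ?N" "i < n" for i x y
    proof -
      have "\<pi> i (?m x y) = (\<Sum>j<n. if j = i then path_algebra_mult (F i) (\<pi> i x) (\<pi> i y) else 0)"
        unfolding \<pi>_def mult[OF that(1,2)] direct_sum_mult_def lookup_sum
        by (intro sum.cong) (auto simp: lookup_single when_def)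
      then show ?thesis using that(3) by simp
    qed
    have preimage: "\<exists>x\<in>?N. \<phi> x = Poly_Mapping.single i z"
      if "i < n" "z \<in> path_algebra (F i)" for i z
    proof -
      have "Poly_Mapping.single i z \<in> ?S"
        using that subspace_0[OF subspace_path_algebra]
        by (auto simp: direct_sum_space_def lookup_single when_def)
      then show ?thesis using bij by (metis bij_betw_imp_surj_on imageE)
    qed
    \<comment> \<open>Every summand must be visible on the arrows of \<open>Q\<close>, since the
      argument below only sees arrow coefficients. For this \<open>z\<close> is replaced by an arrow
      of \<open>F i\<close>.\<close>
    have generator: "\<exists>x\<in>?N. \<exists>a z. \<phi> x = Poly_Mapping.single i z \<and> z \<noteq> 0 \<and> lookup x [a] \<noteq> 0"
      if i: "i < n" for i
    proof -
      obtain z where z: "z \<in> path_algebra (F i)" "z \<noteq> 0"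
        using F[OF i] subspace_0[OF subspace_path_algebra[of "F i"]] by blast
      obtain p where "lookup z p \<noteq> 0" using z(2) by (metis lookup_zero poly_mapping_eqI)
      then have "p \<in> quiver_paths (F i)" using path_algebra_lookup[OF z(1)] by blast
      \<comment> \<open>The first arrow of any path in the support of \<open>z\<close> shows that
        \<open>F i\<close> has an arrow at all.\<close>
      then have c: "[hd p] \<in> quiver_paths (F i)"
        using F[OF i] hd_in_set[of p]
        by (auto simp: finite_acyclic_quiver_def fin_digraph_def quiver_paths_iff simp del: hd_in_set)
      define c where "c = hd p"
      have "Poly_Mapping.single [c] 1 \<in> path_algebra (F i)"
        using c by (auto simp: path_algebra_def free_space_def c_def)
      then obtain x where x: "x \<in> ?N" "\<phi> x = Poly_Mapping.single i (Poly_Mapping.single [c] 1)"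
        using preimage i by blast
      \<comment> \<open>Otherwise \<open>x\<close> is a combination of products, but the arrow \<open>c\<close> is not.\<close>
      have "\<exists>a. lookup x [a] \<noteq> 0"
      proof (rule ccontr)
        assume "\<not> ?thesis"
        then have no_arrow: "lookup x [a] = 0" for a by simp
        \<comment> \<open>A linear functional that is zero on products, hence on all paths of length
          at least two, but takes the value 1 at \<open>x\<close>.\<close>
        define f where "f y = lookup (\<pi> i y) [c]" for y
        have lin_f: "linear_on ?N f"
          unfolding linear_on_def f_def \<pi>_def by (simp add: \<phi>_add \<phi>_scale lookup_add)
        have path: "p \<in> quiver_paths Q" if "p \<in> Poly_Mapping.keys x" for p
          using x(1) that by (auto simp: path_algebra_def free_space_def)
        have single_N: "Poly_Mapping.single p 1 \<in> ?N" if "p \<in> quiver_paths Q" for p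
          using that by (auto simp: path_algebra_def free_space_def)
        have f0: "f (Poly_Mapping.single p 1) = 0" if p: "p \<in> Poly_Mapping.keys x" for p
        proof -
          obtain a q where q: "p = [a] @ q" "q \<noteq> []"
            using p no_arrow[of "hd p"] path[OF p]
            by (cases p; cases "tl p") (auto simp: in_keys_iff quiver_paths_def)
          then have "[a] \<in> quiver_paths Q" "q \<in> quiver_paths Q"
            using path[OF p] by (auto simp: quiver_paths_iff[OF wf] successively_Cons)
          then have "f (Poly_Mapping.single p 1) = lookup (path_algebra_mult (F i)
              (\<pi> i (Poly_Mapping.single [a] 1)) (\<pi> i (Poly_Mapping.single q 1))) [c]"
            using path_mult_single[of "[a]" q Q] path[OF p] q(1) i single_N \<pi>_mult
            unfolding f_def by metis
          also have "\<dots> = 0"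
            using \<pi>_in i single_N \<open>[a] \<in> quiver_paths Q\<close> \<open>q \<in> quiver_paths Q\<close>
            by (intro path_mult_one_arrow) auto
          finally show ?thesis .
        qed
        have "x = (\<Sum>p\<in>Poly_Mapping.keys x. lookup x p *\<^sub>R Poly_Mapping.single p 1)"
          by (rule free_space_expansion) (auto simp: free_space_def)
        then have "f x = f (\<Sum>p\<in>Poly_Mapping.keys x. lookup x p *\<^sub>R Poly_Mapping.single p 1)"
          by simp
        also have "\<dots> = (\<Sum>p\<in>Poly_Mapping.keys x. f (lookup x p *\<^sub>R Poly_Mapping.single p 1))"
          using path single_N N(3) by (intro linear_on_sum[OF subspace_path_algebra lin_f]) auto
        also have "\<dots> = (\<Sum>p\<in>Poly_Mapping.keys x. lookup x p *\<^sub>R f (Poly_Mapping.single p 1))"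
          using path single_N lin_f by (intro sum.cong) (auto simp: linear_on_def)
        also have "\<dots> = 0" using f0 by simp
        finally show False using x(2) by (simp add: f_def \<pi>_def)
      qed
      then show ?thesis using x by (metis lookup_single_eq lookup_zero zero_neq_one)
    qed
    \<comment> \<open>Merging all summands except number 0 into \<open>B\<close> reduces
      \<open>n\<close> summands to two ideals annihilating each other.\<close>
    define A where "A = {x \<in> ?N. \<forall>i. i \<noteq> 0 \<longrightarrow> \<pi> i x = 0}"
    define B where "B = {x \<in> ?N. \<pi> 0 x = 0}"
    have annihilate: "?m x y = 0" if "x \<in> A \<and> y \<in> B \<or> x \<in> B \<and> y \<in> A" for x y
    proof (rule \<phi>_inj)
      have xy: "x \<in> ?N" "y \<in> ?N" using that by (auto simp: A_def B_def)
      have "\<pi> i (?m x y) = 0" for i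
      proof (cases "i < n")
        case True
        have "\<pi> i x = 0 \<or> \<pi> i y = 0"
          using that unfolding A_def B_def by (cases "i = 0") blast+
        then show ?thesis using \<pi>_mult[OF xy True] path_mult_zero by auto
      qed (simp add: \<pi>_out path_mult_in_path_algebra)
      then show "\<phi> (?m x y) = \<phi> 0" by (intro poly_mapping_eqI) (simp add: \<pi>_def \<phi>0)
    qed (simp_all add: path_mult_in_path_algebra N)
    define hasA where "hasA a \<longleftrightarrow> (\<exists>x\<in>A. lookup x [a] \<noteq> 0)" for a
    define hasB where "hasB a \<longleftrightarrow> (\<exists>x\<in>B. lookup x [a] \<noteq> 0)" for a
    \<comment> \<open>The arrow is the sum of \<open>u\<close> in \<open>A\<close> and
      \<open>x - u\<close> in \<open>B\<close>, so its coefficient 1 at \<open>[a]\<close> cannot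
      vanish in both parts.\<close>
    have one: "hasA a \<or> hasB a" if "a \<in> arcs Q" for a
    proof -
      have "[a] \<in> quiver_paths Q" using that by (simp add: quiver_paths_iff[OF wf])
      then have x: "Poly_Mapping.single [a] 1 \<in> ?N"
        by (auto simp: path_algebra_def free_space_def)
      define x where "x = Poly_Mapping.single [a] (1 :: real)"
      obtain u where u: "u \<in> ?N" "\<phi> u = Poly_Mapping.single 0 (\<pi> 0 x)"
        using preimage[of 0 "\<pi> 0 x"] \<pi>_in[of x 0] x n by (auto simp: x_def)
      have "u \<in> A" using u by (auto simp: A_def \<pi>_def lookup_single when_def)
      moreover have "x - u \<in> B"
        using u x \<phi>_diff[of x u] N(4) by (simp add: B_def x_def \<pi>_def lookup_minus)
      moreover have "lookup u [a] \<noteq> 0 \<or> lookup (x - u) [a] \<noteq> 0"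
        by (auto simp: lookup_minus x_def)
      ultimately show ?thesis unfolding hasA_def hasB_def by blast
    qed
    \<comment> \<open>From \<open>hasA a\<close>, \<open>excl\<close> forbids \<open>hasB b\<close>;
      then \<open>one\<close> yields \<open>hasA b\<close>, and \<open>excl\<close> in turn forbids
      \<open>hasB a\<close>.\<close>
    have step: "hasA b \<and> \<not> hasB a \<and> \<not> hasB b" if "(a, b) \<in> arc_adjacency Q" "hasA a" for a b
    proof -
      have prod0: "lookup x [c] * lookup y [d] = 0"
        if "x \<in> A \<and> y \<in> B \<or> x \<in> B \<and> y \<in> A" "c \<in> arcs Q" "d \<in> arcs Q" "head Q c = tail Q d"
        for x y c d
      proof -
        have "[c, d] \<in> quiver_paths Q" using that by (simp add: quiver_paths_iff[OF wf])
        moreover have "x \<in> ?N" "y \<in> ?N" using that by (auto simp: A_def B_def)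
        ultimately show ?thesis
          using path_mult_two_arrows[of x Q y c d] annihilate[OF that(1)] by simp
      qed
      have excl: "\<not> (hasA c \<and> hasB d) \<and> \<not> (hasB c \<and> hasA d)"
        if "c \<in> arcs Q" "d \<in> arcs Q" "head Q c = tail Q d" for c d
        using prod0 that unfolding hasA_def hasB_def by (metis mult_eq_0_iff)
      show ?thesis
        using excl[of a b] excl[of b a] one[of a] one[of b] that
        by (auto simp: arc_adjacency_def)
    qed
    obtain x\<^sub>0 a\<^sub>0 z\<^sub>0 where x0: "x\<^sub>0 \<in> ?N" "\<phi> x\<^sub>0 = Poly_Mapping.single 0 z\<^sub>0" "lookup x\<^sub>0 [a\<^sub>0] \<noteq> 0"
      using generator[of 0] n by auto
    obtain x\<^sub>1 a\<^sub>1 z\<^sub>1 where x1: "x\<^sub>1 \<in> ?N" "\<phi> x\<^sub>1 = Poly_Mapping.single 1 z\<^sub>1" "z\<^sub>1 \<noteq> 0" "lookup x\<^sub>1 [a\<^sub>1] \<noteq> 0"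
      using generator[of 1] n by auto
    have "x\<^sub>0 \<in> A" using x0 by (auto simp: A_def \<pi>_def lookup_single when_def)
    have "x\<^sub>1 \<in> B" using x1 by (auto simp: B_def \<pi>_def lookup_single when_def)
    have "[a\<^sub>0] \<in> quiver_paths Q" "[a\<^sub>1] \<in> quiver_paths Q"
      using path_algebra_lookup[OF x0(1)] x0(3) path_algebra_lookup[OF x1(1)] x1(4) by blast+
    then have arcs: "a\<^sub>0 \<in> arcs Q" "a\<^sub>1 \<in> arcs Q" by (auto simp: quiver_paths_iff[OF wf])
    have hasB1: "hasB a\<^sub>1" using x1(4) \<open>x\<^sub>1 \<in> B\<close> by (auto simp: hasB_def)
    have hasA1: "hasA a\<^sub>1" using conn[OF arcs]
    proof (induction rule: rtrancl_induct)
      case base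
      show ?case using x0(3) \<open>x\<^sub>0 \<in> A\<close> by (auto simp: hasA_def)
    qed (use step in blast)
    \<comment> \<open>By \<open>step\<close>, only an arrow without neighbours can occur in both
      ideals, as \<open>a\<^sub>1\<close> does. Then \<open>a\<^sub>1\<close> is the only arrow and
      the path algebra is one-dimensional, too small for two nonzero summands.\<close>
    have isolated: "(a\<^sub>1, b) \<notin> arc_adjacency Q" for b using step[of a\<^sub>1 b] hasA1 hasB1 by blast
    then have only: "b = a\<^sub>1" if "b \<in> arcs Q" for b
      using conn[OF arcs(2) that] by (metis converse_rtranclE)
    have paths: "p = [a\<^sub>1]" if "p \<in> quiver_paths Q" for p
    proof -
      have p: "p \<noteq> []" "set p \<subseteq> arcs Q" "successively (\<lambda>a b. head Q a = tail Q b) p"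
        using that by (auto simp: quiver_paths_iff[OF wf])
      show ?thesis
      proof (cases p)
        case (Cons a q)
        show ?thesis
        proof (cases q)
          case Nil
          then show ?thesis using Cons p only by auto
        next
          case (Cons b q')
          then have "(a, b) \<in> arc_adjacency Q" "a = a\<^sub>1"
            using p \<open>p = a # q\<close> only by (auto simp: arc_adjacency_def)
          then show ?thesis using isolated by blast
        qed
      qed (use p in simp)
    qed
    have "lookup x\<^sub>0 [a\<^sub>1] *\<^sub>R x\<^sub>1 = lookup x\<^sub>1 [a\<^sub>1] *\<^sub>R x\<^sub>0"
    proof (rule poly_mapping_eqI)
      fix p
      show "lookup (lookup x\<^sub>0 [a\<^sub>1] *\<^sub>R x\<^sub>1) p = lookup (lookup x\<^sub>1 [a\<^sub>1] *\<^sub>R x\<^sub>0) p"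
        using paths[of p] path_algebra_lookup[OF x0(1), of p] path_algebra_lookup[OF x1(1), of p]
        by (cases "p \<in> quiver_paths Q") auto
    qed
    then have "lookup x\<^sub>0 [a\<^sub>1] *\<^sub>R \<phi> x\<^sub>1 = lookup x\<^sub>1 [a\<^sub>1] *\<^sub>R \<phi> x\<^sub>0"
      using \<phi>_scale x0(1) x1(1) by metis
    then have "lookup (lookup x\<^sub>0 [a\<^sub>1] *\<^sub>R \<phi> x\<^sub>1) 1 = lookup (lookup x\<^sub>1 [a\<^sub>1] *\<^sub>R \<phi> x\<^sub>0) 1" by simp
    then have "lookup x\<^sub>0 [a\<^sub>1] *\<^sub>R z\<^sub>1 = 0" by (simp add: x0(2) x1(2) lookup_single)
    moreover have "a\<^sub>0 = a\<^sub>1" using only arcs by blast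
    ultimately show False using x0(3) x1(3) by simp
  qed
  then show ?thesis unfolding algebraically_connected_def using Q by blast
qed


section \<open>Classes of arrows as algebraically connected components\<close>

definition arc_class :: "('a, 'b) pre_digraph \<Rightarrow> 'b \<Rightarrow> 'b set" where
  "arc_class Q a = (arc_adjacency Q)\<^sup>* `` {a}"

text \<open>Only endpoints of arrows in the class are kept as vertices, because components must not
  have isolated vertices; two components may still share a vertex.\<close>

definition arc_component :: "('a, 'b) pre_digraph \<Rightarrow> 'b \<Rightarrow> ('a, 'b) pre_digraph" where
  "arc_component Q a =
     \<lparr> verts = tail Q ` arc_class Q a \<union> head Q ` arc_class Q a, arcs = arc_class Q a,
       tail = tail Q, head = head Q \<rparr>"

lemma arc_component_simps [simp]:
  "arcs (arc_component Q a) = arc_class Q a" "tail (arc_component Q a) = tail Q"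
  "head (arc_component Q a) = head Q"
  by (simp_all add: arc_component_def)

lemma arc_class_self: "a \<in> arc_class Q a"
  by (simp add: arc_class_def)

lemma arc_class_subset: "a \<in> arcs Q \<Longrightarrow> arc_class Q a \<subseteq> arcs Q"
  unfolding arc_class_def by (auto elim: rtranclE simp: arc_adjacency_def)

lemma arc_class_eq: "b \<in> arc_class Q a \<Longrightarrow> arc_class Q b = arc_class Q a"
  using sym_rtrancl[OF sym_arc_adjacency[of Q]] unfolding arc_class_def
  by (auto dest: symD intro: rtrancl_trans)

lemma arc_class_step: "b \<in> arc_class Q a \<Longrightarrow> (b, c) \<in> arc_adjacency Q \<Longrightarrow> c \<in> arc_class Q a"
  unfolding arc_class_def by (auto intro: rtrancl_into_rtrancl)

lemma arc_component_eqI: "b \<in> arc_class Q a \<Longrightarrow> arc_component Q b = arc_component Q a"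
  by (simp add: arc_component_def arc_class_eq)

lemma wf_arc_component: "wf_digraph (arc_component Q a)"
  by standard (auto simp: arc_component_def)

lemma path_in_arc_class:
  assumes "successively (\<lambda>a b. head Q a = tail Q b) p" "set p \<subseteq> arcs Q" "p \<noteq> []"
  shows "set p \<subseteq> arc_class Q (hd p)"
  using assms
proof (induction p rule: induct_list012)
  case (3 a b p)
  then have "b \<in> arc_class Q a"
    by (intro arc_class_step[OF arc_class_self]) (auto simp: arc_adjacency_def)
  then have "arc_class Q b = arc_class Q a" by (rule arc_class_eq)
  moreover have "set (b # p) \<subseteq> arc_class Q b" using 3 by simp
  ultimately show ?case using arc_class_self[of a Q] by simp
qed (simp_all add: arc_class_self)

text \<open>Consecutive arrows of a path are adjacent, so a path never leaves the class of its first
  arrow.\<close>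

lemma quiver_paths_arc_component:
  assumes "wf_digraph Q" "a \<in> arcs Q"
  shows "p \<in> quiver_paths (arc_component Q a) \<longleftrightarrow> p \<in> quiver_paths Q \<and> hd p \<in> arc_class Q a"
proof
  assume "p \<in> quiver_paths (arc_component Q a)"
  then show "p \<in> quiver_paths Q \<and> hd p \<in> arc_class Q a"
    using arc_class_subset[OF assms(2)] hd_in_set[of p]
    by (auto simp: quiver_paths_iff assms(1) wf_arc_component simp del: hd_in_set)
next
  assume p: "p \<in> quiver_paths Q \<and> hd p \<in> arc_class Q a"
  then have "set p \<subseteq> arc_class Q (hd p)"
    by (intro path_in_arc_class) (auto simp: quiver_paths_iff[OF assms(1)])
  then show "p \<in> quiver_paths (arc_component Q a)"
    using p arc_class_eq[of "hd p" Q a] by (auto simp: quiver_paths_iff assms(1) wf_arc_component)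
qed

lemma awalk_arc_component:
  assumes "a \<in> arcs Q" "wf_digraph Q" "pre_digraph.awalk (arc_component Q a) u p v"
  shows "pre_digraph.awalk Q u p v"
proof -
  have "pre_digraph.cas (arc_component Q a) u p v = pre_digraph.cas Q u p v"
    by (induction p arbitrary: u) (simp_all add: pre_digraph.cas.simps)
  moreover have "verts (arc_component Q a) \<subseteq> verts Q"
    using arc_class_subset[OF assms(1)] wf_digraph.wellformed[OF assms(2)]
    by (auto simp: arc_component_def)
  ultimately show ?thesis
    using assms(3) arc_class_subset[OF assms(1)] by (auto simp: pre_digraph.awalk_def)
qed

lemma finite_acyclic_arc_component:
  assumes Q: "finite_acyclic_quiver Q" and a: "a \<in> arcs Q"
  shows "finite_acyclic_quiver (arc_component Q a)"
proof -
  have fin: "fin_digraph Q" and wf: "wf_digraph Q"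
    using Q by (auto simp: finite_acyclic_quiver_def fin_digraph_def)
  have "finite (arc_class Q a)"
    using fin_digraph.finite_arcs[OF fin] arc_class_subset[OF a] by (rule finite_subset[rotated])
  then have "fin_digraph (arc_component Q a)"
    using wf_arc_component by (auto simp: fin_digraph_def fin_digraph_axioms_def arc_component_def)
  then show ?thesis
    using Q awalk_arc_component[OF a wf] unfolding finite_acyclic_quiver_def by blast
qed

lemma algebraically_connected_arc_component:
  assumes Q: "finite_acyclic_quiver Q" and a: "a \<in> arcs Q"
  shows "algebraically_connected (arc_component Q a)"
proof (rule algebraically_connectedI[OF finite_acyclic_arc_component[OF Q a]])
  fix b c assume "b \<in> arcs (arc_component Q a)" "c \<in> arcs (arc_component Q a)"
  then have b: "b \<in> arc_class Q a" and "c \<in> arc_class Q b" by (simp_all add: arc_class_eq)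
  then have "(b, c) \<in> (arc_adjacency Q)\<^sup>*" by (simp add: arc_class_def)
  then show "(b, c) \<in> (arc_adjacency (arc_component Q a))\<^sup>*"
  proof (induction rule: rtrancl_induct)
    case (step c d)
    then have "c \<in> arc_class Q a" using b unfolding arc_class_def by (auto intro: rtrancl_trans)
    moreover from this have "d \<in> arc_class Q a" using step(2) by (rule arc_class_step)
    ultimately have "(c, d) \<in> arc_adjacency (arc_component Q a)"
      using step(2) by (auto simp: arc_adjacency_def)
    then show ?case using step(3) by (rule rtrancl_into_rtrancl[rotated])
  qed simp
qed

text \<open>Each path lies in exactly one class, so the path bases of the components partition that
  of \<open>Q\<close>. As \<open>algebraic_components\<close> collects the members of any
  decomposition, exhibiting this one makes the hypotheses of the theorem applicable to the
  classes.\<close>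

theorem algebraic_decomposition_arc_components:
  assumes Q: "finite_acyclic_quiver Q"
  shows "algebraic_decomposition Q (arc_component Q ` arcs Q)"
proof -
  let ?I = "arc_component Q ` arcs Q"
  have fin: "fin_digraph Q" and wf: "wf_digraph Q"
    using Q by (auto simp: finite_acyclic_quiver_def fin_digraph_def)
  note paths = quiver_paths_arc_component[OF wf]
  have subgraph: "subgraph (arc_component Q a) Q" if "a \<in> arcs Q" for a
    using arc_class_subset[OF that] wf wf_arc_component wf_digraph.wellformed[OF wf]
    by (auto simp: subgraph_def compatible_def arc_component_def)
  have finI: "finite ?I" using fin_digraph.finite_arcs[OF fin] by simp
  have disjoint: "disjoint_family_on quiver_paths ?I"
    unfolding disjoint_family_on_def
  proof (intro ballI impI)
    fix E E' assume E: "E \<in> ?I" "E' \<in> ?I" "E \<noteq> E'"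
    have "False" if p: "p \<in> quiver_paths E" "p \<in> quiver_paths E'" for p
    proof -
      obtain a b where "E = arc_component Q a" "a \<in> arcs Q" "E' = arc_component Q b" "b \<in> arcs Q"
        using E(1,2) by blast
      then show False using p E(3) paths arc_component_eqI[of "hd p" Q] by metis
    qed
    then show "quiver_paths E \<inter> quiver_paths E' = {}" by blast
  qed
  have union: "quiver_paths Q = (\<Union>E\<in>?I. quiver_paths E)"
  proof
    show "quiver_paths Q \<subseteq> (\<Union>E\<in>?I. quiver_paths E)"
    proof
      fix p assume p: "p \<in> quiver_paths Q"
      then have "p \<noteq> []" "set p \<subseteq> arcs Q" using quiver_paths_iff[OF wf] by blast+
      then have "hd p \<in> arcs Q" using hd_in_set[of p] by blast
      moreover from this have "p \<in> quiver_paths (arc_component Q (hd p))"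
        using p paths[of "hd p" p] arc_class_self[of "hd p" Q] by simp
      ultimately show "p \<in> (\<Union>E\<in>?I. quiver_paths E)" by blast
    qed
    show "(\<Union>E\<in>?I. quiver_paths E) \<subseteq> quiver_paths Q" using paths by (simp add: subset_iff)
  qed
  \<comment> \<open>At the junction of \<open>p\<close> and \<open>q\<close> two arrows are
    adjacent. Hence products inside a component stay there and products across components
    vanish.\<close>
  have concat: "E = E' \<and> p @ q \<in> quiver_paths E"
    if I: "E \<in> ?I" "E' \<in> ?I"
      and pq: "p \<in> quiver_paths E" "q \<in> quiver_paths E'" "p @ q \<in> quiver_paths Q"
    for E E' p q
  proof -
    obtain a b where E: "E = arc_component Q a" "a \<in> arcs Q" "E' = arc_component Q b" "b \<in> arcs Q"
      using I by blast
    have ne: "p \<noteq> []" "q \<noteq> []" using pq by (auto simp: quiver_paths_def)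
    have hd: "hd p \<in> arc_class Q a" "hd q \<in> arc_class Q b"
      using pq(1,2) paths[OF E(2)] paths[OF E(4)] E(1,3) by simp_all
    have "set (p @ q) \<subseteq> arc_class Q (hd (p @ q))"
      using pq(3) by (intro path_in_arc_class) (auto simp: quiver_paths_iff[OF wf])
    then have "hd q \<in> arc_class Q (hd p)" using ne hd_in_set[of q] by auto
    then have "arc_component Q (hd q) = arc_component Q (hd p)" by (rule arc_component_eqI)
    then have "E = E'"
      using arc_component_eqI[OF hd(1)] arc_component_eqI[OF hd(2)] E(1,3) by simp
    then show ?thesis using pq(3) paths[OF E(2)] E(1) hd(1) ne by simp
  qed
  have mult: "lookup (path_algebra_mult Q x y) c = (\<Sum>p\<in>Poly_Mapping.keys x \<union> Poly_Mapping.keys y.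
      \<Sum>q\<in>Poly_Mapping.keys x \<union> Poly_Mapping.keys y.
      if p @ q = c \<and> c \<in> quiver_paths Q then lookup x p * lookup y q else 0)" for x y c
    by (intro path_mult_lookup) auto
  have "path_algebra_mult Q x y \<in> path_algebra E"
    if E: "E \<in> ?I" and xy: "x \<in> path_algebra E" "y \<in> path_algebra E" for E x y
  proof -
    have "lookup (path_algebra_mult Q x y) c = 0" if "c \<notin> quiver_paths E" for c
      unfolding mult using path_algebra_lookup[OF xy(1)] path_algebra_lookup[OF xy(2)] concat[OF E E] that
      by (intro sum.neutral ballI) auto
    then show ?thesis unfolding path_algebra_def free_space_iff by blast
  qed
  moreover have "path_algebra_mult Q x y = 0"
    if E: "E \<in> ?I" "E' \<in> ?I" "E \<noteq> E'" and xy: "x \<in> path_algebra E" "y \<in> path_algebra E'"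
    for E E' x y
  proof (rule poly_mapping_eqI)
    fix c
    show "lookup (path_algebra_mult Q x y) c = lookup 0 c"
    proof -
      have "lookup x p * lookup y q = 0" if "p @ q \<in> quiver_paths Q" for p q
        using concat[OF E(1,2), of p q] E(3) that
          path_algebra_lookup[OF xy(1), of p] path_algebra_lookup[OF xy(2), of q] by auto
      then show ?thesis unfolding mult lookup_zero by (intro sum.neutral ballI) simp
    qed
  qed
  moreover have "path_algebra E \<subseteq> path_algebra Q" if "E \<in> ?I" for E
    unfolding path_algebra_def using that union by (intro free_space_mono) blast
  moreover have "\<exists>!f. f \<in> (\<Pi>\<^sub>E E\<in>?I. path_algebra E) \<and> x = (\<Sum>E\<in>?I. f E)"
    if "x \<in> path_algebra Q" for x
    using free_space_direct_sum[OF finI disjoint] that union by (simp add: path_algebra_def)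
  ultimately have "internal_direct_sum (path_algebra Q) (path_algebra_mult Q) ?I path_algebra"
    unfolding internal_direct_sum_def using finI subspace_path_algebra by (intro conjI ballI impI) auto
  moreover have "subgraph E Q \<and> arcs E \<noteq> {} \<and>
      (\<forall>v\<in>verts E. \<exists>a\<in>arcs E. v = tail E a \<or> v = head E a) \<and> algebraically_connected E"
    if E: "E \<in> ?I" for E
  proof -
    obtain a where a: "a \<in> arcs Q" "E = arc_component Q a" using E by auto
    then show ?thesis
      using subgraph algebraically_connected_arc_component[OF Q] arc_class_self[of a Q]
      by (auto simp: arc_component_def)
  qed
  ultimately show ?thesis unfolding algebraic_decomposition_def by blast
qed

section \<open>Array components\<close>

lemma hasse_quiver_simps [simp]:
  "verts (hasse_quiver P r) = P" "tail (hasse_quiver P r) = fst" "head (hasse_quiver P r) = snd"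
  by (simp_all add: hasse_quiver_def)

lemma hasse_arcs_iff:
  "(a, b) \<in> arcs (hasse_quiver P r) \<longleftrightarrow>
     a \<in> P \<and> b \<in> P \<and> (a, b) \<in> r \<and> a \<noteq> b \<and> \<not> (\<exists>t\<in>P - {a, b}. (a, t) \<in> r \<and> (t, b) \<in> r)"
  by (simp add: hasse_quiver_def)

lemma awalk_imp_trancl:
  assumes "tail E = fst" "head E = snd" "pre_digraph.awalk E s p t" "p \<noteq> []"
  shows "(s, t) \<in> (arcs E)\<^sup>+"
proof -
  have "pre_digraph.cas E s p t \<Longrightarrow> set p \<subseteq> arcs E \<Longrightarrow> (s, t) \<in> (arcs E)\<^sup>*" for s p
  proof (induction p arbitrary: s)
    case (Cons e p)
    then have "(s, snd e) \<in> arcs E" "(snd e, t) \<in> (arcs E)\<^sup>*"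
      using assms(1,2) by (auto simp: pre_digraph.cas.simps)
    then show ?case by (rule converse_rtrancl_into_rtrancl)
  qed (simp add: pre_digraph.cas.simps)
  note rt = this
  obtain e p' where p: "p = e # p'" using assms(4) by (cases p) auto
  then have "(s, snd e) \<in> arcs E" "(snd e, t) \<in> (arcs E)\<^sup>*"
    using assms rt[of "snd e" p'] by (auto simp: pre_digraph.awalk_def pre_digraph.cas.simps)
  then show ?thesis by (rule rtrancl_into_trancl2)
qed

lemma trancl_imp_awalk:
  assumes "wf_digraph E" "tail E = fst" "head E = snd" "(s, t) \<in> (arcs E)\<^sup>+"
  shows "\<exists>p. p \<noteq> [] \<and> pre_digraph.awalk E s p t"
  using assms(4)
proof (induction rule: trancl_induct)
  case (base y)
  then show ?case
    using wf_digraph.tail_in_verts[OF assms(1) base] assms(2,3)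
    by (intro exI[of _ "[(s, y)]"]) (simp add: pre_digraph.awalk_def pre_digraph.cas.simps)
next
  case (step y z)
  then obtain p where p: "p \<noteq> []" "pre_digraph.awalk E s p y" by blast
  have "pre_digraph.awalk E y [(y, z)] z"
    using wf_digraph.tail_in_verts[OF assms(1) step(2)] step(2) assms(2,3)
    by (simp add: pre_digraph.awalk_def pre_digraph.cas.simps)
  then show ?case using p wf_digraph.awalk_appendI[OF assms(1)] by blast
qed

text \<open>An explicit form of the transitive closure: only column numbers and membership in the
  chosen sets matter. The last clause recovers the order from its Hasse quiver, the only thing that
  the hypothesis on components provides.\<close>

lemma array_taosE:
  assumes "array_taos P r"
  obtains k :: nat and C M :: "nat \<Rightarrow> 'a set"
  where "\<And>j. 2 \<le> j \<Longrightarrow> j \<le> k \<Longrightarrow> M j \<subseteq> C j" "disjoint_family_on C {1..k}"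
    "\<And>s t. (s, t) \<in> r \<longleftrightarrow> (\<exists>i j. 1 \<le> i \<and> i < j \<and> j \<le> k \<and> s \<in> C i \<and> t \<in> M j)"
    "r = (arcs (hasse_quiver P r))\<^sup>+"
proof -
  obtain k :: nat and n m :: "nat \<Rightarrow> nat" and C M :: "nat \<Rightarrow> 'a set"
    where k: "2 \<le> k" and nm: "\<forall>i\<in>{1..k}. 1 \<le> n i \<and> 1 \<le> m i \<and> m i \<le> n i"
      and P: "P = (\<Union>i\<in>{1..k}. C i)" and disj: "disjoint_family_on C {1..k}"
      and M: "\<forall>i\<in>{1..<k}. M (Suc i) \<subseteq> C (Suc i) \<and> card (M (Suc i)) = m (Suc i)"
      and r: "r = (\<Union>i\<in>{1..<k}. C i \<times> M (Suc i))\<^sup>+"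
    using assms unfolding array_taos_def by auto
  define R where "R = (\<Union>i\<in>{1..<k}. C i \<times> M (Suc i))"
  \<comment> \<open>Nonempty chosen sets allow a chain to pass through all intermediate columns. The
    bound 2 appears because \<open>M 1\<close> is unconstrained.\<close>
  have MC: "M j \<subseteq> C j" and Mne: "M j \<noteq> {}" if "2 \<le> j" "j \<le> k" for j
  proof -
    obtain i where "j = Suc i" "i \<in> {1..<k}" using \<open>2 \<le> j\<close> \<open>j \<le> k\<close> by (cases j) auto
    then have "M j \<subseteq> C j" "card (M j) \<ge> 1" using M nm by auto
    then show "M j \<subseteq> C j" "M j \<noteq> {}" by auto
  qed
  have level: "i = j" if "x \<in> C i" "x \<in> C j" "1 \<le> i" "i \<le> k" "1 \<le> j" "j \<le> k" for x i j
    using disj that by (fastforce simp: disjoint_family_on_def)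
  have r_iff: "(s, t) \<in> r \<longleftrightarrow> (\<exists>i j. 1 \<le> i \<and> i < j \<and> j \<le> k \<and> s \<in> C i \<and> t \<in> M j)" for s t
  proof
    assume "(s, t) \<in> r"
    then show "\<exists>i j. 1 \<le> i \<and> i < j \<and> j \<le> k \<and> s \<in> C i \<and> t \<in> M j"
      unfolding r
    proof (induction rule: trancl_induct)
      case (base y)
      then obtain i where "i \<in> {1..<k}" "s \<in> C i" "y \<in> M (Suc i)" by blast
      then show ?case by (intro exI[of _ i] exI[of _ "Suc i"]) auto
    next
      case (step y z)
      then obtain i j where ij: "1 \<le> i" "i < j" "j \<le> k" "s \<in> C i" "y \<in> M j" by blast
      obtain l where l: "l \<in> {1..<k}" "y \<in> C l" "z \<in> M (Suc l)" using step(2) by blast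
      have "y \<in> C j" using MC[of j] ij by auto
      then have "j = l" using level[of y j l] ij l by auto
      then show ?case using ij l by (intro exI[of _ i] exI[of _ "Suc l"]) auto
    qed
  next
    assume "\<exists>i j. 1 \<le> i \<and> i < j \<and> j \<le> k \<and> s \<in> C i \<and> t \<in> M j"
    then obtain i j where ij: "1 \<le> i" "i < j" "j \<le> k" "s \<in> C i" "t \<in> M j" by blast
    from \<open>i < j\<close> have "Suc i \<le> j" by simp
    then show "(s, t) \<in> r"
      using ij(3,5)
    proof (induction j arbitrary: t rule: dec_induct)
      case base
      then have "(s, t) \<in> R" unfolding R_def using ij by (intro UN_I[of i]) auto
      then show ?case unfolding r R_def by (rule r_into_trancl)
    next
      case (step j)
      then obtain y where y: "y \<in> M j" using Mne[of j] ij(1) by auto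
      have "(s, y) \<in> r" using step y by auto
      moreover have "y \<in> C j" using y MC[of j] step ij(1) by auto
      then have "(y, t) \<in> R" unfolding R_def using step ij(1) by (intro UN_I[of j]) auto
      ultimately show ?case unfolding r R_def by (rule trancl_into_trancl)
    qed
  qed
  \<comment> \<open>A generating relation raises the column number by one and every relation by at
    least one, so no element fits in between.\<close>
  have "R \<subseteq> arcs (hasse_quiver P r)"
  proof (clarify)
    fix a b assume "(a, b) \<in> R"
    then obtain i where i: "i \<in> {1..<k}" "a \<in> C i" "b \<in> M (Suc i)" unfolding R_def by blast
    then have b: "b \<in> C (Suc i)" using MC[of "Suc i"] by auto
    have "\<not> ((a, t) \<in> r \<and> (t, b) \<in> r)" for t
    proof
      assume "(a, t) \<in> r \<and> (t, b) \<in> r"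
      then obtain i1 j1 i2 j2 where *: "1 \<le> i1" "i1 < j1" "j1 \<le> k" "a \<in> C i1" "t \<in> M j1"
        "1 \<le> i2" "i2 < j2" "j2 \<le> k" "t \<in> C i2" "b \<in> M j2"
        unfolding r_iff by blast
      have "i1 = i" using level[of a i1 i] * i by auto
      moreover have "j1 = i2" using level[of t j1 i2] MC[of j1] * by auto
      moreover have "j2 = Suc i" using level[of b j2 "Suc i"] MC[of j2] * b i by auto
      ultimately show False using * by simp
    qed
    moreover have "(a, b) \<in> r" unfolding r_iff using i by (intro exI[of _ i] exI[of _ "Suc i"]) auto
    moreover have "a \<noteq> b" using level[of a i "Suc i"] i b by auto
    moreover have "a \<in> P" "b \<in> P" unfolding P using i b by auto
    ultimately show "(a, b) \<in> arcs (hasse_quiver P r)" by (auto simp: hasse_arcs_iff)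
  qed
  then have "r \<subseteq> (arcs (hasse_quiver P r))\<^sup>+"
    unfolding r R_def by (rule trancl_mono_subset)
  moreover have "(arcs (hasse_quiver P r))\<^sup>+ \<subseteq> r\<^sup>+"
    by (rule trancl_mono_subset) (auto simp: hasse_arcs_iff)
  moreover have "r\<^sup>+ = r" unfolding r by (rule trancl_id) (rule trans_trancl)
  ultimately have "r = (arcs (hasse_quiver P r))\<^sup>+" by simp
  with MC disj r_iff show ?thesis by (rule that)
qed

text \<open>An element with relations on both sides is a chosen one of an inner column, and its
  neighbours depend on the column number only. Different columns make two such elements comparable,
  equal columns give them the same neighbours.\<close>

lemma array_taos_levels:
  assumes "array_taos P r" "(s, t) \<in> r" "(t, v) \<in> r" "(s', x) \<in> r" "(x, v') \<in> r"
  shows "(x, t) \<in> r \<or> (t, x) \<in> r \<or>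
    ((\<forall>u. (u, x) \<in> r \<longleftrightarrow> (u, t) \<in> r) \<and> (\<forall>u. (x, u) \<in> r \<longleftrightarrow> (t, u) \<in> r))"
proof -
  obtain k C M where MC: "\<And>j. 2 \<le> j \<Longrightarrow> j \<le> k \<Longrightarrow> M j \<subseteq> C j"
    and disj: "disjoint_family_on C {1..k :: nat}"
    and r: "\<And>s t. (s, t) \<in> r \<longleftrightarrow> (\<exists>i j. 1 \<le> i \<and> i < j \<and> j \<le> k \<and> s \<in> C i \<and> t \<in> M j)"
    using assms(1) by (rule array_taosE) blast
  have level: "i = j" if "x \<in> C i" "x \<in> C j" "1 \<le> i" "i \<le> k" "1 \<le> j" "j \<le> k" for x i j
    using disj that by (fastforce simp: disjoint_family_on_def)
  have interior: "\<exists>j. 2 \<le> j \<and> j < k \<and> t \<in> M j \<and>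
      (\<forall>u. (u, t) \<in> r \<longleftrightarrow> (\<exists>i. 1 \<le> i \<and> i < j \<and> u \<in> C i)) \<and>
      (\<forall>u. (t, u) \<in> r \<longleftrightarrow> (\<exists>l. j < l \<and> l \<le> k \<and> u \<in> M l))"
    if st: "(s, t) \<in> r" and tv: "(t, v) \<in> r" for s t v
  proof -
    obtain i j where ij: "1 \<le> i" "i < j" "j \<le> k" "t \<in> M j" using st r by blast
    obtain i' j' where ij': "1 \<le> i'" "i' < j'" "j' \<le> k" "t \<in> C i'" using tv r by blast
    have t: "t \<in> C j" using MC[of j] ij by auto
    then have j: "j < k" using level[of t j i'] ij ij' by auto
    have "(u, t) \<in> r \<longleftrightarrow> (\<exists>i. 1 \<le> i \<and> i < j \<and> u \<in> C i)" for u
    proof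
      assume "(u, t) \<in> r"
      then obtain a b where ab: "1 \<le> a" "a < b" "b \<le> k" "u \<in> C a" "t \<in> M b" using r by blast
      then have "b = j" using level[of t b j] t MC[of b] ij by auto
      then show "\<exists>i. 1 \<le> i \<and> i < j \<and> u \<in> C i" using ab by blast
    qed (use r ij in blast)
    moreover have "(t, u) \<in> r \<longleftrightarrow> (\<exists>l. j < l \<and> l \<le> k \<and> u \<in> M l)" for u
    proof
      assume "(t, u) \<in> r"
      then obtain a b where ab: "1 \<le> a" "a < b" "b \<le> k" "t \<in> C a" "u \<in> M b" using r by blast
      then have "a = j" using level[of t a j] t ij by auto
      then show "\<exists>l. j < l \<and> l \<le> k \<and> u \<in> M l" using ab by blast
    next
      assume "\<exists>l. j < l \<and> l \<le> k \<and> u \<in> M l"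
      moreover have "1 \<le> j" using ij by simp
      ultimately show "(t, u) \<in> r" using r t by blast
    qed
    ultimately show ?thesis using ij j by (intro exI[of _ j]) auto
  qed
  obtain j where j: "2 \<le> j" "j < k" "t \<in> M j"
    "\<And>u. (u, t) \<in> r \<longleftrightarrow> (\<exists>i. 1 \<le> i \<and> i < j \<and> u \<in> C i)"
    "\<And>u. (t, u) \<in> r \<longleftrightarrow> (\<exists>l. j < l \<and> l \<le> k \<and> u \<in> M l)"
    using interior[OF assms(2,3)] by blast
  obtain l where l: "2 \<le> l" "l < k" "x \<in> M l"
    "\<And>u. (u, x) \<in> r \<longleftrightarrow> (\<exists>i. 1 \<le> i \<and> i < l \<and> u \<in> C i)"
    "\<And>u. (x, u) \<in> r \<longleftrightarrow> (\<exists>m. l < m \<and> m \<le> k \<and> u \<in> M m)"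
    using interior[OF assms(4,5)] by blast
  consider "l < j" | "j < l" | "j = l" by linarith
  then show ?thesis
  proof cases
    case 1
    then have "(x, t) \<in> r" using l(5)[of t] j(2,3) by (meson less_imp_le)
    then show ?thesis ..
  next
    case 2
    then have "(t, x) \<in> r" using j(5)[of x] l(2,3) by (meson less_imp_le)
    then show ?thesis by blast
  next
    case 3
    then show ?thesis using j l by simp
  qed
qed

section \<open>The order of a TAOS and the arrow classes of its Hasse quiver\<close>

context finite_taos
begin

abbreviation "H \<equiv> hasse_quiver P r"

lemma hasse_arcs_subset: "arcs H \<subseteq> B"
  by (auto simp: hasse_arcs_iff B_iff)

text \<open>Induction on the number of elements strictly between \<open>s\<close> and
  \<open>v\<close>: an intermediate \<open>t\<close> yields two intervals with fewer of them, as
  \<open>t\<close> itself lies inside neither.\<close>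

lemma B_eq_trancl_hasse: "B = (arcs H)\<^sup>+"
proof
  have "(s, v) \<in> (arcs H)\<^sup>+" if "(s, v) \<in> B" for s v
    using that
  proof (induction "card {t. (s, t) \<in> B \<and> (t, v) \<in> B}" arbitrary: s v rule: less_induct)
    case less
    show ?case
    proof (cases "\<exists>t. (s, t) \<in> B \<and> (t, v) \<in> B")
      case False
      then have "(s, v) \<in> arcs H"
        using less(2) B_subset[OF less(2)] by (auto simp: hasse_arcs_iff B_iff)
      then show ?thesis ..
    next
      case True
      then obtain t where t: "(s, t) \<in> B" "(t, v) \<in> B" by blast
      have fin: "finite {t. (s, t) \<in> B \<and> (t, v) \<in> B}" for s v
        using finite_P by (rule finite_subset[rotated]) (use B_subset in blast)
      have "{x. (s, x) \<in> B \<and> (x, t) \<in> B} \<subset> {x. (s, x) \<in> B \<and> (x, v) \<in> B}"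
        using t B_trans B_irrefl by blast
      moreover have "{x. (t, x) \<in> B \<and> (x, v) \<in> B} \<subset> {x. (s, x) \<in> B \<and> (x, v) \<in> B}"
        using t B_trans B_irrefl by blast
      ultimately have "(s, t) \<in> (arcs H)\<^sup>+" "(t, v) \<in> (arcs H)\<^sup>+"
        using less(1)[OF _ t(1)] less(1)[OF _ t(2)] psubset_card_mono[OF fin] by blast+
      then show ?thesis by (rule trancl_trans)
    qed
  qed
  then show "B \<subseteq> (arcs H)\<^sup>+" by auto
  have "(arcs H)\<^sup>+ \<subseteq> B\<^sup>+" by (rule trancl_mono_subset[OF hasse_arcs_subset])
  moreover have "B\<^sup>+ = B" using B_trans by (intro trancl_id transI)
  ultimately show "(arcs H)\<^sup>+ \<subseteq> B" by simp
qed

lemma wf_hasse: "wf_digraph H"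
  by standard (auto simp: hasse_arcs_iff)

lemma finite_acyclic_hasse: "finite_acyclic_quiver H"
proof -
  have "fin_digraph H"
    using wf_hasse finite_P finite_subset[OF hasse_arcs_subset finite_B]
    by (simp add: fin_digraph_def fin_digraph_axioms_def)
  moreover have "\<not> pre_digraph.awalk H u p u" if "p \<noteq> []" for u p
    using awalk_imp_trancl[of H u p u] that B_irrefl B_eq_trancl_hasse by auto
  ultimately show ?thesis by (auto simp: finite_acyclic_quiver_def)
qed

lemma arc_component_in_components:
  "a \<in> arcs H \<Longrightarrow> arc_component H a \<in> algebraic_components H"
  unfolding algebraic_components_def
  using algebraic_decomposition_arc_components[OF finite_acyclic_hasse] by blast

lemma class_trancl_subset:
  assumes "a \<in> arcs H" shows "(arc_class H a)\<^sup>+ \<subseteq> B"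
  unfolding B_eq_trancl_hasse by (rule trancl_mono_subset[OF arc_class_subset[OF assms]])

text \<open>The last arrow of a chain into \<open>t\<close> and the first arrow of a chain out of
  \<open>t\<close> are adjacent, so a vertex with relations on both sides belongs to a single class
  in this sense.\<close>

lemma class_trancl_unique:
  assumes a: "a \<in> arcs H" and b: "b \<in> arcs H"
    and st: "(s, t) \<in> (arc_class H a)\<^sup>+" and tv: "(t, v) \<in> (arc_class H b)\<^sup>+"
  shows "arc_class H a = arc_class H b"
proof -
  obtain x where x: "(x, t) \<in> arc_class H a" using st by (meson tranclE)
  obtain y where y: "(t, y) \<in> arc_class H b" using tv by (meson converse_tranclE)
  have "((x, t), (t, y)) \<in> arc_adjacency H"
    using x y arc_class_subset[OF a] arc_class_subset[OF b] by (auto simp: arc_adjacency_def)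
  then have "(t, y) \<in> arc_class H a" by (rule arc_class_step[OF x])
  then show ?thesis using y arc_class_eq by metis
qed

lemma B_in_class:
  assumes "(s, t) \<in> B" shows "\<exists>a\<in>arcs H. (s, t) \<in> (arc_class H a)\<^sup>+"
  using assms unfolding B_eq_trancl_hasse
proof (induction rule: trancl_induct)
  case (base y)
  then show ?case by (intro bexI[of _ "(s, y)"] r_into_trancl arc_class_self)
next
  case (step y z)
  then obtain a where a: "a \<in> arcs H" "(s, y) \<in> (arc_class H a)\<^sup>+" by blast
  have yz: "(y, z) \<in> (arc_class H (y, z))\<^sup>+" using arc_class_self by (rule r_into_trancl)
  have "arc_class H a = arc_class H (y, z)"
    using class_trancl_unique[OF a(1) step(2) a(2) yz] .
  then have "(s, z) \<in> (arc_class H a)\<^sup>+" using trancl_trans[OF a(2)] yz by simp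
  then show ?case using a(1) by blast
qed

text \<open>Supplies the paths of length at least two to which the hypothesis on parallel paths
  refers.\<close>

lemma class_awalk2:
  assumes "a \<in> arcs H" "(s, t) \<in> (arc_class H a)\<^sup>+" "(t, v) \<in> (arc_class H a)\<^sup>+"
  shows "\<exists>p. pre_digraph.awalk (arc_component H a) s p v \<and> 2 \<le> length p"
proof -
  let ?E = "arc_component H a"
  obtain p where p: "p \<noteq> []" "pre_digraph.awalk ?E s p t"
    using trancl_imp_awalk[OF wf_arc_component, of H a s t] assms by auto
  obtain p' where p': "p' \<noteq> []" "pre_digraph.awalk ?E t p' v"
    using trancl_imp_awalk[OF wf_arc_component, of H a t v] assms by auto
  have "pre_digraph.awalk ?E s (p @ p') v"
    using wf_digraph.awalk_appendI[OF wf_arc_component p(2) p'(2)] .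
  moreover have "2 \<le> length (p @ p')" using p(1) p'(1) by (cases p; cases p') auto
  ultimately show ?thesis by blast
qed

lemma between_cases:
  assumes array: "\<And>E. E \<in> algebraic_components H \<Longrightarrow> \<exists>P' r'. array_taos P' r' \<and> E = hasse_quiver P' r'"
    and parallel: "\<And>E F. \<lbrakk>E \<in> algebraic_components H; F \<in> algebraic_components H; E \<noteq> F\<rbrakk> \<Longrightarrow>
      \<not> (\<exists>p q s t. pre_digraph.awalk E s p t \<and> 2 \<le> length p \<and>
                   pre_digraph.awalk F s q t \<and> 2 \<le> length q)"
    and B: "(s, t) \<in> B" "(t, v) \<in> B" "(s, x) \<in> B" "(x, v) \<in> B"
  shows "(x, t) \<in> B \<or> (t, x) \<in> B \<or>
    ({u. (u, x) \<in> B} = {u. (u, t) \<in> B} \<and> {u. (x, u) \<in> B} = {u. (t, u) \<in> B})"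
proof -
  have through: "\<exists>a\<in>arcs H. (s, y) \<in> (arc_class H a)\<^sup>+ \<and> (y, v) \<in> (arc_class H a)\<^sup>+"
    if sy: "(s, y) \<in> B" and yv: "(y, v) \<in> B" for y
  proof -
    obtain a where a: "a \<in> arcs H" "(s, y) \<in> (arc_class H a)\<^sup>+" using B_in_class[OF sy] by blast
    obtain b where b: "b \<in> arcs H" "(y, v) \<in> (arc_class H b)\<^sup>+" using B_in_class[OF yv] by blast
    have "arc_class H a = arc_class H b" using class_trancl_unique[OF a(1) b(1) a(2) b(2)] .
    then show ?thesis using a b by auto
  qed
  obtain a where a: "a \<in> arcs H" "(s, t) \<in> (arc_class H a)\<^sup>+" "(t, v) \<in> (arc_class H a)\<^sup>+"
    using through B by blast
  obtain b where b: "b \<in> arcs H" "(s, x) \<in> (arc_class H b)\<^sup>+" "(x, v) \<in> (arc_class H b)\<^sup>+"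
    using through B by blast
  \<comment> \<open>Through \<open>t\<close> and through \<open>x\<close> run paths of length at
    least two from \<open>s\<close> to \<open>v\<close>; in distinct components they would be
    parallel.\<close>
  have "arc_component H a = arc_component H b"
    using parallel[OF arc_component_in_components[OF a(1)] arc_component_in_components[OF b(1)]]
      class_awalk2[OF a] class_awalk2[OF b] by blast
  then have ab: "arc_class H b = arc_class H a" by (metis arc_component_simps(1))
  obtain P' r' where arr: "array_taos P' r'" "arc_component H a = hasse_quiver P' r'"
    using array[OF arc_component_in_components[OF a(1)]] by blast
  have "r' = (arcs (hasse_quiver P' r'))\<^sup>+" using arr(1) by (rule array_taosE)
  then have r': "r' = (arc_class H a)\<^sup>+" using arr(2) by (metis arc_component_simps(1))
  have in_r': "(s, t) \<in> r'" "(t, v) \<in> r'" "(s, x) \<in> r'" "(x, v) \<in> r'"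
    using a b ab r' by simp_all
  \<comment> \<open>For an inner element \<open>y\<close> of the component, any relation of
    \<open>P\<close> at \<open>y\<close> continues one of the class and so belongs to it. Neighbours
    in \<open>P\<close> and in the array thus agree, which need not hold at the ends of the
    component.\<close>
  have global: "(u, y) \<in> B \<longleftrightarrow> (u, y) \<in> r'" "(y, u) \<in> B \<longleftrightarrow> (y, u) \<in> r'"
    if y: "(s, y) \<in> r'" "(y, v) \<in> r'" for u y
  proof -
    show "(u, y) \<in> B \<longleftrightarrow> (u, y) \<in> r'"
      using B_in_class[of u y] class_trancl_unique[OF _ a(1), of _ u y v] class_trancl_subset[OF a(1)]
        y r' by auto
    show "(y, u) \<in> B \<longleftrightarrow> (y, u) \<in> r'"
      using B_in_class[of y u] class_trancl_unique[OF a(1), of _ s y u] class_trancl_subset[OF a(1)]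
        y r' by auto
  qed
  show ?thesis
    using array_taos_levels[OF arr(1) in_r'] class_trancl_subset[OF a(1)] r'
      global[OF in_r'(1,2)] global[OF in_r'(3,4)] by auto
qed

end

theorem theorem5p3:
  fixes P :: "'a set" and r :: "'a rel"
  assumes "finite P" and "taos P r"
    and "\<And>E. E \<in> algebraic_components (hasse_quiver P r) \<Longrightarrow>
           \<exists>P' r'. array_taos P' r' \<and> E = hasse_quiver P' r'"
    and "\<And>E F. \<lbrakk>E \<in> algebraic_components (hasse_quiver P r);
                 F \<in> algebraic_components (hasse_quiver P r); E \<noteq> F\<rbrakk> \<Longrightarrow>
           \<not> (\<exists>p q s t. pre_digraph.awalk E s p t \<and> 2 \<le> length p \<and>
                        pre_digraph.awalk F s q t \<and> 2 \<le> length q)"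
  shows "\<exists>ip. algebraic_ricci_soliton (taos_algebra P r) taos_bracket ip (- 1)"
proof -
  interpret finite_taos P r using assms(1,2) by unfold_locales
  define pred where "pred t = {u. (u, t) \<in> B}" for t
  define succ where "succ t = {u. (t, u) \<in> B}" for t
  define K where "K t = insert t {x \<in> P. pred x = pred t \<and> succ x = succ t}" for t
  \<comment> \<open>For a triple \<open>s \<prec> t \<prec> v\<close>, additivity of \<open>1 + ric\<close> amounts to \<open>2 * q t = |pred t| + |succ t| + |K t|\<close>.
    The set \<open>K t\<close> is the set of chosen elements in the column of \<open>t\<close>; inserting \<open>t\<close> only matters
    outside of \<open>P\<close>, where it keeps \<open>q\<close> positive.\<close>
  define q where "q t = (card (pred t) + card (succ t) + card (K t)) / 2" for t
  have finK: "finite (K t)" for t using finite_P by (simp add: K_def)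
  have q_pos: "q t > 0" for t
  proof -
    have "card (K t) > 0" using finK by (auto simp: card_gt_0_iff K_def)
    then show ?thesis by (simp add: q_def)
  qed
  interpret weighted_taos P r q using q_pos by unfold_locales
  have "ric (s, v) = ric (s, t) + ric (t, v) + 1" if st: "(s, t) \<in> B" and tv: "(t, v) \<in> B" for s t v
  proof -
    have t: "t \<in> P" using st B_subset by blast
    have K_iff: "x \<in> K t \<longleftrightarrow> x \<in> P \<and> pred x = pred t \<and> succ x = succ t" for x
      using t by (auto simp: K_def)
    \<comment> \<open>Having the same predecessors and successors is an equivalence relation, so all
      three cardinalities in \<open>q\<close> agree on \<open>K t\<close>.\<close>
    have q_eq: "q x = q t" if "x \<in> K t" for x
    proof -
      have "K x = K t" using that t by (auto simp: K_iff K_def)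
      then show ?thesis using that by (simp add: K_iff q_def)
    qed
    let ?I = "\<lambda>s v. {x. (s, x) \<in> B \<and> (x, v) \<in> B}"
    have fin: "finite (?I s v)" for s v
      using finite_P by (rule finite_subset[rotated]) (use B_subset in blast)
    have split: "?I s v = K t \<union> (?I s t \<union> ?I t v)"
    proof (intro equalityI subsetI)
      fix x assume x: "x \<in> ?I s v"
      then have "(x, t) \<in> B \<or> (t, x) \<in> B \<or>
        ({u. (u, x) \<in> B} = {u. (u, t) \<in> B} \<and> {u. (x, u) \<in> B} = {u. (t, u) \<in> B})"
        using between_cases[OF assms(3,4) st tv] by blast
      then show "x \<in> K t \<union> (?I s t \<union> ?I t v)"
        using x B_subset by (auto simp: K_iff pred_def succ_def)
    next
      fix x assume "x \<in> K t \<union> (?I s t \<union> ?I t v)"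
      then show "x \<in> ?I s v"
        using st tv B_trans unfolding K_iff pred_def succ_def Un_iff mem_Collect_eq by blast
    qed
    \<comment> \<open>If \<open>x\<close> were below or above \<open>t\<close>, it would be so for
      itself, because \<open>x\<close> and \<open>t\<close> have the same predecessors and
      successors.\<close>
    have "(x, t) \<notin> B \<and> (t, x) \<notin> B" if "x \<in> K t" for x
      using that B_irrefl[of x] unfolding K_iff pred_def succ_def by blast
    then have disj1: "K t \<inter> (?I s t \<union> ?I t v) = {}" by blast
    have disj2: "?I s t \<inter> ?I t v = {}" using B_asym by blast
    have "(\<Sum>x\<in>?I s v. 1 / q x) = (\<Sum>x\<in>K t. 1 / q x) + (\<Sum>x\<in>?I s t. 1 / q x) + (\<Sum>x\<in>?I t v. 1 / q x)"
      unfolding split by (simp add: sum.union_disjoint finK fin disj1 disj2)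
    also have "(\<Sum>x\<in>K t. 1 / q x) = card (K t) / q t" using q_eq by simp
    \<comment> \<open>The choice of \<open>q\<close> enters here: halved, the 2 becomes the required
      summand 1, and the two quotients become the boundary terms of \<open>ric (s, t)\<close> and
      \<open>ric (t, v)\<close> at \<open>t\<close>.\<close>
    also have "card (K t) / q t = 2 - card (succ t) / q t - card (pred t) / q t"
    proof -
      have "real (card (K t)) = 2 * q t - card (succ t) - card (pred t)"
        by (simp add: q_def field_simps)
      then show ?thesis using q_pos[of t] by (simp add: diff_divide_distrib)
    qed
    finally show ?thesis by (simp add: ric_def pred_def succ_def field_simps)
  qed
  then show ?thesis using soliton by blast
qed

end
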